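(* For any integer $t\ge 2$, any randomized single-pass streaming algorithm that, given the edges of an $n$-vertex graph in an adversarially chosen order, outputs a $(1+1/(2t))$-approximation to the value of the maximum cut requires $\Omega(n^{1-1/t})$ space.
   Context: The maximum cut value of $G=(V,E)$ is $\mathrm{OPT}=\max_{P\cup Q=V,\,P\cap Q=\emptyset}|E\cap(P\times Q)|$. A randomized algorithm is a $\gamma$-approximation algorithm (for $\gamma\ge1$) if on every input graph it outputs a value in $[\mathrm{OPT}/\gamma,\mathrm{OPT}]$ with probability at least $3/4$. In the adversarial order model, the edge order is chosen by an oblivious adversary that does not know the algorithm's coin tosses. Space is measured in bits. *)

theory Defs
  imports "HOL-Probability.Probability"
begin

definition simple_graph :: "'v set \<Rightarrow> 'v set set \<Rightarrow> bool" where
  "simple_graph V E \<longleftrightarrow> finite V \<and> (\<forall>e\<in>E. e \<subseteq> V \<and> card e = 2)"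

text \<open>Edges are unordered, so the cut edges in \<open>E \<inter> (P \<times> Q)\<close> are the sets \<open>{p, q} \<in> E\<close>.\<close>

definition cut_edges :: "'v set set \<Rightarrow> 'v set \<Rightarrow> 'v set \<Rightarrow> 'v set set" where
  "cut_edges E P Q = {e \<in> E. \<exists>p\<in>P. \<exists>q\<in>Q. e = {p, q}}"

definition max_cut :: "'v set \<Rightarrow> 'v set set \<Rightarrow> nat" where
  "max_cut V E = Max {card (cut_edges E P Q) | P Q. P \<union> Q = V \<and> P \<inter> Q = {}}"

text \<open>
  \<open>coins\<close> is the distribution of all coin tosses of a run. The update function sees the position
  of the current edge so that it can use coin tosses that are fresh at that step. Only the memory
  content, a bit string, is carried from one step to the next. The coin tosses themselves are not
  charged as space.
\<close>

record 'r stream_alg =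
  coins :: "'r measure"
  init_mem :: "'r \<Rightarrow> bool list"
  update_mem :: "'r \<Rightarrow> nat \<Rightarrow> bool list \<Rightarrow> nat set \<Rightarrow> bool list"
  result :: "'r \<Rightarrow> bool list \<Rightarrow> real"

definition final_mem :: "'r stream_alg \<Rightarrow> 'r \<Rightarrow> nat set list \<Rightarrow> bool list" where
  "final_mem A \<omega> es =
     foldl (\<lambda>m (i, e). update_mem A \<omega> i m e) (init_mem A \<omega>) (List.enumerate 0 es)"

text \<open>An arrival order of the edges of the \<open>n\<close>-vertex graph \<open>({..<n}, E)\<close>, each edge arriving once.\<close>

definition edge_order :: "nat \<Rightarrow> nat set set \<Rightarrow> nat set list \<Rightarrow> bool" where
  "edge_order n E es \<longleftrightarrow> simple_graph {..<n} E \<and> distinct es \<and> set es = E"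

text \<open>
  A prefix of an edge order is an edge order of a subgraph, so this bounds the memory
  throughout the run and not only at its end.
\<close>

definition uses_space :: "nat \<Rightarrow> 'r stream_alg \<Rightarrow> nat \<Rightarrow> bool" where
  "uses_space n A s \<longleftrightarrow>
     (\<forall>E es. edge_order n E es \<longrightarrow>
       (\<forall>\<omega>\<in>space (coins A). length (final_mem A \<omega> es) \<le> s))"

text \<open>
  The adversary is oblivious: graph and order are fixed before the coins are tossed.
  A non-measurable success event has measure \<open>0\<close> and so counts as failure.
\<close>

definition approximates_max_cut :: "nat \<Rightarrow> real \<Rightarrow> 'r stream_alg \<Rightarrow> bool" where
  "approximates_max_cut n \<gamma> A \<longleftrightarrow>
     prob_space (coins A) \<and>
     (\<forall>E es. edge_order n E es \<longrightarrow>
       measure (coins A)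
         {\<omega> \<in> space (coins A).
            result A \<omega> (final_mem A \<omega> es)
              \<in> {real (max_cut {..<n} E) / \<gamma> .. real (max_cut {..<n} E)}} \<ge> 3 / 4)"

end

theory Submission
  imports Defs "HOL-Real_Asymp.Real_Asymp"
begin

text \<open>
  The proof reduces from a \<open>t\<close>-partite Boolean hidden hypermatching problem. Alice holds \<open>m\<close> bits in
  each of \<open>t\<close> parts, Bob holds \<open>N\<close> disjoint hyperedges with one bit position in each part, and a
  label for every hyperedge; either all labels equal the parities of Alice's bits along the
  hyperedges or all differ from them.

  Every hyperedge becomes a pair of walks of length \<open>2 * t - 1\<close> between two hub vertices, with \<open>t\<close>
  edges of Alice and \<open>t - 1\<close> edges of Bob; a bit or a label decides whether the two walks swap. If
  labels and parities differ, the graph is bipartite. If they agree, all walks are closed, hence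
  edge-disjoint odd closed walks, and every cut misses an edge of each. As \<open>2 * t - 1 < 2 * t + 1\<close>,
  the maximum cuts differ by a factor of more than \<open>1 + 1 / (2 * t)\<close> once \<open>N\<close> is close to \<open>m\<close>.

  For the communication bound, a message of fewer than \<open>K\<close> bits confines Alice's input to a set \<open>A\<close>
  which for most inputs has density at least \<open>2 ^ - K\<close>. By Parseval, Bob's squared advantage averaged
  over the hypermatchings is at most a sum over \<open>k \<ge> 1\<close> of the Fourier weight of \<open>A\<close> at level
  \<open>t * k\<close> divided by \<open>(m choose k) ^ (t - 1)\<close>. Hypercontractivity bounds this weight for \<open>k \<le> K\<close>
  and Parseval does so for larger \<open>k\<close>; the sum is small when \<open>K\<close> is a small multiple of
  \<open>m powr (1 - 1 / t)\<close>.
\<close>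

section \<open>Hypercontractivity on the discrete cube\<close>

lemma one_plus_powr_le:
  fixes x r :: real
  assumes "x \<ge> 0" "0 \<le> r" "r \<le> 1"
  shows "(1 + x) powr r \<le> 1 + r * x"
proof -
  have "(1 + x) powr r * 1 powr (1 - r) \<le> r * (1 + x) + (1 - r) * 1"
    using assms by (intro Youngs_inequality_0) auto
  then show ?thesis by (simp add: algebra_simps)
qed

text \<open>The difference of the two sides vanishes at \<open>0\<close>. Its derivative is
  nonnegative by AM-GM, because \<open>(1 + y) powr (\<rho> - 1)\<close> and
  \<open>(1 - y) powr (\<rho> - 1)\<close> have a product of at least 1.\<close>

lemma powr_one_plus_minus_diff_ge:
  fixes y \<rho> :: real
  assumes "0 \<le> y" "y < 1" "0 \<le> \<rho>" "\<rho> \<le> 1"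
  shows "2 * \<rho> * y \<le> (1 + y) powr \<rho> - (1 - y) powr \<rho>"
proof -
  let ?g = "\<lambda>y::real. (1 + y) powr \<rho> - (1 - y) powr \<rho> - 2 * \<rho> * y"
  have "?g 0 \<le> ?g y"
  proof (rule DERIV_nonneg_imp_nondecreasing[OF assms(1)])
    fix x :: real assume x: "0 \<le> x" "x \<le> y"
    then have x1: "x < 1" using assms by simp
    let ?a = "(1 + x) powr (\<rho> - 1)" and ?b = "(1 - x) powr (\<rho> - 1)"
    have d: "(?g has_real_derivative \<rho> * ?a + \<rho> * ?b - 2 * \<rho>) (at x)"
      using x x1 by (auto intro!: derivative_eq_intros)
    have ab: "?a * ?b = (1 - x\<^sup>2) powr (\<rho> - 1)"
      using x x1 by (simp add: powr_mult [symmetric] power2_eq_square algebra_simps)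
    have "0 < 1 - x\<^sup>2" using x x1 by (simp add: power_less_one_iff abs_square_less_1)
    then have "(1 - x\<^sup>2) powr 0 \<le> (1 - x\<^sup>2) powr (\<rho> - 1)"
      using assms by (intro powr_mono') auto
    then have "?a * ?b \<ge> 1" using ab \<open>0 < 1 - x\<^sup>2\<close> by simp
    moreover have "(?a + ?b)\<^sup>2 = (?a - ?b)\<^sup>2 + 4 * (?a * ?b)"
      by (simp add: power2_eq_square algebra_simps)
    moreover have "(?a - ?b)\<^sup>2 \<ge> 0" by simp
    ultimately have "(?a + ?b)\<^sup>2 \<ge> 4" by linarith
    then have "(?a + ?b)\<^sup>2 \<ge> 2\<^sup>2" by simp
    then have "?a + ?b \<ge> 2" by (rule power2_le_imp_le) simp
    then have "\<rho> * (?a + ?b) \<ge> \<rho> * 2" using assms by (intro mult_left_mono)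
    then show "\<exists>z. (?g has_real_derivative z) (at x) \<and> 0 \<le> z"
      using d by (auto simp: algebra_simps)
  qed
  then show ?thesis by simp
qed

text \<open>Differentiating in \<open>y\<close> gives \<open>1 + \<rho>\<close> times the preceding
  inequality.\<close>

lemma powr_one_plus_minus_sum_ge:
  fixes y \<rho> :: real
  assumes "0 \<le> y" "y \<le> 1" "0 \<le> \<rho>" "\<rho> \<le> 1"
  shows "2 + \<rho> * (1 + \<rho>) * y\<^sup>2 \<le> (1 + y) powr (1 + \<rho>) + (1 - y) powr (1 + \<rho>)"
proof -
  let ?g = "\<lambda>y::real. (1 + y) powr (1 + \<rho>) + (1 - y) powr (1 + \<rho>) - \<rho> * (1 + \<rho>) * y\<^sup>2"
  have "?g 0 \<le> ?g y"
  \<comment> \<open>The open interval avoids \<open>x = 1\<close>, where the base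
    \<open>1 - x\<close> vanishes; the end point follows by continuity.\<close>
  proof (rule DERIV_nonneg_imp_increasing_open[OF assms(1)])
    fix x :: real assume x: "0 < x" "x < y"
    then have x1: "x < 1" using assms by simp
    have d: "(?g has_real_derivative
        (1 + \<rho>) * (1 + x) powr \<rho> - (1 + \<rho>) * (1 - x) powr \<rho> - \<rho> * (1 + \<rho>) * (2 * x)) (at x)"
      using x x1 by (auto intro!: derivative_eq_intros)
    have "(1 + \<rho>) * (2 * \<rho> * x) \<le> (1 + \<rho>) * ((1 + x) powr \<rho> - (1 - x) powr \<rho>)"
      using powr_one_plus_minus_diff_ge[of x \<rho>] x x1 assms by (intro mult_left_mono) auto
    then show "\<exists>z. (?g has_real_derivative z) (at x) \<and> 0 \<le> z"
      using d by (auto simp: algebra_simps)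
  next
    show "continuous_on {0..y} ?g"
      using assms by (intro continuous_intros continuous_on_powr') auto
  qed
  then show ?thesis by simp
qed

text \<open>This is hypercontractivity on a single bit, for the function with values
  \<open>a\<close> and \<open>b\<close>. By symmetry and homogeneity only
  \<open>y = (a - b) / (a + b)\<close> matters. The claim becomes a comparison of
  \<open>(1 + \<rho> * y\<^sup>2) powr (p / 2)\<close> with the mean of
  \<open>(1 + y) powr p\<close> and \<open>(1 - y) powr p\<close>, where
  \<open>p = 1 + \<rho>\<close>; the quadratic \<open>1 + p / 2 * \<rho> * y\<^sup>2\<close> lies
  between them.\<close>

lemma two_point_hypercontractive:
  fixes a b \<rho> :: real
  assumes "0 \<le> a" "0 \<le> b" "0 \<le> \<rho>" "\<rho> \<le> 1"
  shows "(a + b)\<^sup>2 + \<rho> * (a - b)\<^sup>2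
    \<le> 2 powr (2 - 2 / (1 + \<rho>)) * (a powr (1 + \<rho>) + b powr (1 + \<rho>)) powr (2 / (1 + \<rho>))"
  using assms(1,2)
proof (induction a b rule: linorder_wlog)
  case (sym a b)
  then show ?case by (simp add: add.commute power2_commute)
next
  case (le b a)
  let ?p = "1 + \<rho>"
  show ?case
  proof (cases "a = 0")
    case True
    then show ?thesis using le by simp
  next
    case False
    define c where "c = (a + b) / 2"
    define y where "y = (a - b) / (a + b)"
    have c: "c > 0" using le False by (simp add: c_def)
    have y: "0 \<le> y" "y \<le> 1" using le False by (auto simp: y_def divide_simps)
    have a: "a = c * (1 + y)" and b: "b = c * (1 - y)"
      using le False by (auto simp: c_def y_def field_simps)
    let ?s = "(1 + y) powr ?p + (1 - y) powr ?p"
    have "(1 + \<rho> * y\<^sup>2) powr (?p / 2) \<le> 1 + ?p / 2 * (\<rho> * y\<^sup>2)"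
      using assms by (intro one_plus_powr_le) auto
    also have "\<dots> \<le> ?s / 2"
      using powr_one_plus_minus_sum_ge[OF y assms(3,4)] by (simp add: field_simps)
    finally have "((1 + \<rho> * y\<^sup>2) powr (?p / 2)) powr (2 / ?p) \<le> (?s / 2) powr (2 / ?p)"
      using assms by (intro powr_mono2) auto
    moreover have "((1 + \<rho> * y\<^sup>2) powr (?p / 2)) powr (2 / ?p) = 1 + \<rho> * y\<^sup>2"
    proof -
      have "?p / 2 * (2 / ?p) = 1" using assms by simp
      moreover have "1 + \<rho> * y\<^sup>2 \<ge> 0" using assms by simp
      ultimately show ?thesis by (simp only: powr_powr powr_one)
    qed
    ultimately have *: "1 + \<rho> * y\<^sup>2 \<le> (?s / 2) powr (2 / ?p)" by simp
    have s0: "?s \<ge> 0" by simp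
    have "(b + a)\<^sup>2 + \<rho> * (b - a)\<^sup>2 = 4 * c\<^sup>2 * (1 + \<rho> * y\<^sup>2)"
      unfolding a b by (simp add: power2_eq_square algebra_simps)
    also have "\<dots> \<le> 4 * c\<^sup>2 * (?s / 2) powr (2 / ?p)"
      using * by (intro mult_left_mono) auto
    also have "\<dots> = 2 powr (2 - 2 / ?p) * (c powr ?p * ?s) powr (2 / ?p)"
    proof -
      have "?p \<noteq> 0" using assms by linarith
      then have "?p * (2 / ?p) = 2" by (metis nonzero_mult_div_cancel_left times_divide_eq_right)
      then have "(c powr ?p * ?s) powr (2 / ?p) = c powr 2 * ?s powr (2 / ?p)"
        using s0 by (simp only: powr_mult powr_powr powr_ge_zero)
      moreover have "c powr 2 = c\<^sup>2" using c by simp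
      moreover have "(?s / 2) powr (2 / ?p) = ?s powr (2 / ?p) / 2 powr (2 / ?p)"
        using s0 by (simp add: powr_divide)
      moreover have "(2::real) powr (2 - 2 / ?p) = 4 / 2 powr (2 / ?p)"
        by (simp add: powr_diff)
      ultimately show ?thesis by simp
    qed
    also have "c powr ?p * ?s = b powr ?p + a powr ?p"
    proof -
      have "(c * (1 + y)) powr ?p = c powr ?p * (1 + y) powr ?p"
        "(c * (1 - y)) powr ?p = c powr ?p * (1 - y) powr ?p"
        using c y by (auto intro!: powr_mult)
      then show ?thesis unfolding a b by (simp only: distrib_left add.commute)
    qed
    finally show ?thesis .
  qed
qed

section \<open>Walsh characters, Parseval and induction over coordinates\<close>

text \<open>Points of the cube are encoded as sets of coordinates whose bit is one.\<close>

definition walsh :: "'a set \<Rightarrow> 'a set \<Rightarrow> real" where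
  "walsh S X = (-1) ^ card (S \<inter> X)"

text \<open>Not normalised: no factor \<open>2 ^ - card I\<close>.\<close>

definition fourier :: "'a set \<Rightarrow> ('a set \<Rightarrow> real) \<Rightarrow> 'a set \<Rightarrow> real" where
  "fourier I f S = (\<Sum>X\<in>Pow I. f X * walsh S X)"

lemma sum_Pow_insert:
  fixes g :: "'a set \<Rightarrow> real"
  assumes "finite I" "a \<notin> I"
  shows "(\<Sum>S\<in>Pow (insert a I). g S) = (\<Sum>S\<in>Pow I. g S + g (insert a S))"
proof -
  have "inj_on (insert a) (Pow I)" using assms(2) by (auto intro!: inj_onI)
  moreover have "Pow I \<inter> insert a ` Pow I = {}" using assms(2) by auto
  ultimately show ?thesis
    using assms(1) by (simp add: Pow_insert sum.union_disjoint sum.reindex sum.distrib)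
qed

lemma walsh_insert:
  assumes "finite I" "a \<notin> I" "S \<subseteq> I" "X \<subseteq> I"
  shows "walsh S (insert a X) = walsh S X"
    and "walsh (insert a S) X = walsh S X"
    and "walsh (insert a S) (insert a X) = - walsh S X"
proof -
  have "a \<notin> S" "a \<notin> X" "finite (S \<inter> X)"
    using assms finite_subset[of S I] by auto
  then show "walsh S (insert a X) = walsh S X" "walsh (insert a S) X = walsh S X"
    "walsh (insert a S) (insert a X) = - walsh S X"
    by (simp_all add: walsh_def)
qed

lemma fourier_insert:
  assumes "finite I" "a \<notin> I" "S \<subseteq> I"
  shows "fourier (insert a I) f S = fourier I f S + fourier I (\<lambda>X. f (insert a X)) S"
    and "fourier (insert a I) f (insert a S) = fourier I f S - fourier I (\<lambda>X. f (insert a X)) S"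
  unfolding fourier_def sum_Pow_insert[OF assms(1,2)] sum.distrib[symmetric] sum_subtractf[symmetric]
  using assms by (auto intro!: sum.cong simp: walsh_insert)

text \<open>Splitting the cube into two faces along \<open>a\<close> drives both inductions below:
  \<open>\<rho> = 1\<close> gives Parseval, and for general \<open>\<rho>\<close> the bracket has
  the shape of the two-point inequality.\<close>

lemma fourier_weight_insert:
  assumes "finite I" "a \<notin> I"
  shows "(\<Sum>S\<in>Pow (insert a I). \<rho> ^ card S * (fourier (insert a I) f S)\<^sup>2) =
    (\<Sum>S\<in>Pow I. \<rho> ^ card S * ((fourier I f S + fourier I (\<lambda>X. f (insert a X)) S)\<^sup>2
        + \<rho> * (fourier I f S - fourier I (\<lambda>X. f (insert a X)) S)\<^sup>2))"
  unfolding sum_Pow_insert[OF assms]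
proof (intro sum.cong refl)
  fix S assume "S \<in> Pow I"
  then have "S \<subseteq> I" "a \<notin> S" "finite S" using assms finite_subset by auto
  then show "\<rho> ^ card S * (fourier (insert a I) f S)\<^sup>2
      + \<rho> ^ card (insert a S) * (fourier (insert a I) f (insert a S))\<^sup>2 =
    \<rho> ^ card S * ((fourier I f S + fourier I (\<lambda>X. f (insert a X)) S)\<^sup>2
        + \<rho> * (fourier I f S - fourier I (\<lambda>X. f (insert a X)) S)\<^sup>2)"
    using assms by (simp add: fourier_insert algebra_simps)
qed

lemma parseval:
  assumes "finite I"
  shows "(\<Sum>S\<in>Pow I. (fourier I f S)\<^sup>2) = 2 ^ card I * (\<Sum>X\<in>Pow I. (f X)\<^sup>2)"
  using assms
proof (induction I arbitrary: f rule: finite_induct)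
  case empty
  show ?case by (simp add: fourier_def walsh_def)
next
  case (insert a I)
  have "(\<Sum>S\<in>Pow (insert a I). (fourier (insert a I) f S)\<^sup>2) =
    (\<Sum>S\<in>Pow I. 2 * (fourier I f S)\<^sup>2 + 2 * (fourier I (\<lambda>X. f (insert a X)) S)\<^sup>2)"
    using fourier_weight_insert[OF insert.hyps, of 1 f]
    by (simp add: power2_sum power2_diff algebra_simps)
  also have "\<dots> = 2 * 2 ^ card I * (\<Sum>X\<in>Pow I. (f X)\<^sup>2 + (f (insert a X))\<^sup>2)"
    by (simp add: sum.distrib sum_distrib_left[symmetric] insert.IH algebra_simps)
  also have "(\<Sum>X\<in>Pow I. (f X)\<^sup>2 + (f (insert a X))\<^sup>2) = (\<Sum>X\<in>Pow (insert a I). (f X)\<^sup>2)"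
    by (simp add: sum_Pow_insert[OF insert.hyps])
  finally show ?case using insert.hyps by simp
qed

text \<open>The Bonami-Beckner inequality from the exponent \<open>1 + \<rho>\<close> to 2,
  tensorised by induction. The power of 2 accounts for sums in place of averages on both
  sides.\<close>

theorem hypercontractivity:
  fixes f :: "'a set \<Rightarrow> real" and \<rho> :: real
  assumes "finite I" and \<rho>: "0 \<le> \<rho>" "\<rho> \<le> 1"
  shows "(\<Sum>S\<in>Pow I. \<rho> ^ card S * (fourier I f S)\<^sup>2) \<le>
    (2 powr (2 - 2 / (1 + \<rho>))) ^ card I * (\<Sum>X\<in>Pow I. \<bar>f X\<bar> powr (1 + \<rho>)) powr (2 / (1 + \<rho>))"
  using assms(1)
proof (induction I arbitrary: f rule: finite_induct)
  case empty
  have "1 + \<rho> \<noteq> 0" using \<rho> by linarith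
  then have "(1 + \<rho>) * (2 / (1 + \<rho>)) = 2"
    by (metis nonzero_mult_div_cancel_left times_divide_eq_right)
  then have "(\<bar>f {}\<bar> powr (1 + \<rho>)) powr (2 / (1 + \<rho>)) = \<bar>f {}\<bar> powr 2"
    by (simp only: powr_powr)
  then show ?case by (simp add: fourier_def walsh_def)
next
  case (insert a I)
  let ?p = "1 + \<rho>"
  let ?C = "2 powr (2 - 2 / ?p)"
  let ?f1 = "\<lambda>X. f (insert a X)"
  define u where "u S = sqrt (\<rho> ^ card S) * fourier I f S" for S
  define v where "v S = sqrt (\<rho> ^ card S) * fourier I ?f1 S" for S
  define U where "U = sqrt (\<Sum>S\<in>Pow I. (u S)\<^sup>2)"
  define V where "V = sqrt (\<Sum>S\<in>Pow I. (v S)\<^sup>2)"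
  define \<alpha> where "\<alpha> = (\<Sum>X\<in>Pow I. \<bar>f X\<bar> powr ?p) powr (1 / ?p)"
  define \<beta> where "\<beta> = (\<Sum>X\<in>Pow I. \<bar>?f1 X\<bar> powr ?p) powr (1 / ?p)"
  define R where "R = sqrt (?C ^ card I)"
  have nonneg: "U \<ge> 0" "V \<ge> 0" "\<alpha> \<ge> 0" "\<beta> \<ge> 0" "R \<ge> 0"
    by (auto simp: U_def V_def \<alpha>_def \<beta>_def R_def intro!: sum_nonneg)
  have U2: "U\<^sup>2 = (\<Sum>S\<in>Pow I. (u S)\<^sup>2)" and V2: "V\<^sup>2 = (\<Sum>S\<in>Pow I. (v S)\<^sup>2)"
    by (auto simp: U_def V_def intro!: real_sqrt_pow2 sum_nonneg)
  have R2: "R\<^sup>2 = ?C ^ card I" by (simp add: R_def)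
  have sq: "(g powr (1 / ?p))\<^sup>2 = g powr (2 / ?p)" for g :: real
    by (simp add: power2_eq_square powr_add[symmetric])
  have "U\<^sup>2 \<le> (R * \<alpha>)\<^sup>2"
    using insert.IH[of f] \<rho>
    by (simp add: U2 u_def power_mult_distrib R2 \<alpha>_def sq)
  then have U: "U \<le> R * \<alpha>" using nonneg by (auto intro: power2_le_imp_le)
  have "V\<^sup>2 \<le> (R * \<beta>)\<^sup>2"
    using insert.IH[of ?f1] \<rho>
    by (simp add: V2 v_def power_mult_distrib R2 \<beta>_def sq)
  then have V: "V \<le> R * \<beta>" using nonneg by (auto intro: power2_le_imp_le)
  have "(\<Sum>S\<in>Pow I. u S * v S)\<^sup>2 \<le> (U * V)\<^sup>2"
    by (simp add: power_mult_distrib U2 V2 Cauchy_Schwarz_ineq_sum)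
  then have uv: "(\<Sum>S\<in>Pow I. u S * v S) \<le> U * V"
    using nonneg by (auto intro: power2_le_imp_le)
  \<comment> \<open>The cross term has the nonnegative coefficient \<open>2 * (1 - \<rho>)\<close>,
    so Cauchy-Schwarz leaves an expression increasing in the two norms \<open>U\<close> and
    \<open>V\<close>. These are replaced by their inductive bounds before the two-point inequality
    is applied.\<close>
  have "(\<Sum>S\<in>Pow (insert a I). \<rho> ^ card S * (fourier (insert a I) f S)\<^sup>2) =
      (\<Sum>S\<in>Pow I. (1 + \<rho>) * ((u S)\<^sup>2 + (v S)\<^sup>2) + 2 * (1 - \<rho>) * (u S * v S))"
    unfolding fourier_weight_insert[OF insert.hyps]
  proof (intro sum.cong refl)
    fix S :: "'a set"
    have "sqrt (\<rho> ^ card S) * sqrt (\<rho> ^ card S) = \<rho> ^ card S" using \<rho> by simp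
    then have "u S * u S = \<rho> ^ card S * (fourier I f S * fourier I f S)"
      "v S * v S = \<rho> ^ card S * (fourier I ?f1 S * fourier I ?f1 S)"
      "u S * v S = \<rho> ^ card S * (fourier I f S * fourier I ?f1 S)"
      unfolding u_def v_def by (simp_all add: algebra_simps)
    then show "\<rho> ^ card S * ((fourier I f S + fourier I ?f1 S)\<^sup>2
        + \<rho> * (fourier I f S - fourier I ?f1 S)\<^sup>2)
      = (1 + \<rho>) * ((u S)\<^sup>2 + (v S)\<^sup>2) + 2 * (1 - \<rho>) * (u S * v S)"
      by (simp add: power2_eq_square algebra_simps)
  qed
  also have "\<dots> = (1 + \<rho>) * (U\<^sup>2 + V\<^sup>2) + 2 * (1 - \<rho>) * (\<Sum>S\<in>Pow I. u S * v S)"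
    by (simp add: sum.distrib U2 V2 flip: sum_distrib_left)
  also have "\<dots> \<le> (1 + \<rho>) * (U\<^sup>2 + V\<^sup>2) + 2 * (1 - \<rho>) * (U * V)"
    using uv \<rho> by (intro add_left_mono mult_left_mono) auto
  also have "\<dots> \<le> (1 + \<rho>) * ((R * \<alpha>)\<^sup>2 + (R * \<beta>)\<^sup>2) + 2 * (1 - \<rho>) * ((R * \<alpha>) * (R * \<beta>))"
    using U V \<rho> nonneg
    by (intro add_mono mult_left_mono power_mono mult_mono) auto
  also have "\<dots> = R\<^sup>2 * ((\<alpha> + \<beta>)\<^sup>2 + \<rho> * (\<alpha> - \<beta>)\<^sup>2)"
    by (simp add: power2_eq_square algebra_simps)
  also have "\<dots> \<le> R\<^sup>2 * (?C * (\<alpha> powr ?p + \<beta> powr ?p) powr (2 / ?p))"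
    using two_point_hypercontractive[of \<alpha> \<beta> \<rho>] nonneg \<rho> by (intro mult_left_mono) auto
  also have "\<alpha> powr ?p + \<beta> powr ?p = (\<Sum>X\<in>Pow (insert a I). \<bar>f X\<bar> powr ?p)"
    using \<rho> by (simp add: \<alpha>_def \<beta>_def powr_powr sum_Pow_insert[OF insert.hyps] sum.distrib sum_nonneg)
  finally show ?case using insert.hyps by (simp add: R2 algebra_simps)
qed

section \<open>Fourier weight of dense sets\<close>

lemma sum_indicator_Pow:
  assumes "finite I" "A \<subseteq> Pow I"
  shows "(\<Sum>X\<in>Pow I. indicator A X :: real) = real (card A)"
proof -
  have "(\<Sum>X\<in>Pow I. indicator A X :: real) = (\<Sum>X\<in>A. indicator A X)"
    using assms by (intro sum.mono_neutral_right) auto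
  then show ?thesis by simp
qed

text \<open>A level inequality: hypercontractivity is applied to the indicator and only level
  \<open>l\<close> is kept. The density bound trades \<open>2 ^ card I\<close> for
  \<open>2 ^ K * card A\<close>, after which the exponents \<open>q\<close> and
  \<open>2 / (1 + \<rho>)\<close> of \<open>card A\<close> add up to 2. The parameter
  \<open>\<rho>\<close> stays free and is later tuned to the level.\<close>

lemma fourier_level_le:
  fixes \<rho> :: real
  assumes I: "finite I" and A: "A \<subseteq> Pow I" and K: "2 ^ card I \<le> 2 ^ K * card A"
    and \<rho>: "0 < \<rho>" "\<rho> \<le> 1"
  shows "(\<Sum>S | S \<subseteq> I \<and> card S = l. (fourier I (indicator A) S)\<^sup>2)
    \<le> (real (card A))\<^sup>2 * ((1 / \<rho>) ^ l * 4 powr (K * \<rho>))"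
proof -
  let ?p = "1 + \<rho>"
  let ?W = "\<Sum>S | S \<subseteq> I \<and> card S = l. (fourier I (indicator A) S)\<^sup>2"
  define a where "a = real (card A)"
  define q where "q = 2 - 2 / ?p"
  have fin: "finite A" using I A finite_subset by blast
  have "card A > 0" using K by (cases "card A = 0") auto
  then have a: "a > 0" by (simp add: a_def)
  have Kr: "2 ^ card I \<le> 2 ^ K * a"
  proof -
    have "real (2 ^ card I) \<le> real (2 ^ K * card A)" using K by (rule of_nat_mono)
    then show ?thesis by (simp add: a_def)
  qed
  have q: "0 \<le> q" "q \<le> 2 * \<rho>"
    using \<rho> by (auto simp: q_def field_simps)
  have "\<rho> ^ l * ?W = (\<Sum>S | S \<subseteq> I \<and> card S = l. \<rho> ^ card S * (fourier I (indicator A) S)\<^sup>2)"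
    unfolding sum_distrib_left by (intro sum.cong) auto
  also have "\<dots> \<le> (\<Sum>S\<in>Pow I. \<rho> ^ card S * (fourier I (indicator A) S)\<^sup>2)"
    using I \<rho> by (intro sum_mono2) auto
  also have "\<dots> \<le> (2 powr q) ^ card I * (\<Sum>X\<in>Pow I. \<bar>indicator A X\<bar> powr ?p) powr (2 / ?p)"
    unfolding q_def using I \<rho> by (intro hypercontractivity) auto
  also have "(\<Sum>X\<in>Pow I. \<bar>indicator A X :: real\<bar> powr ?p) = a"
  proof -
    have "(\<Sum>X\<in>Pow I. \<bar>indicator A X :: real\<bar> powr ?p) = (\<Sum>X\<in>Pow I. indicator A X)"
      by (intro sum.cong) (auto simp: indicator_def)
    also have "\<dots> = a" using I A by (simp add: a_def sum_indicator_Pow)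
    finally show ?thesis .
  qed
  also have "(2 powr q) ^ card I = (2 ^ card I) powr q"
    by (simp add: powr_powr powr_realpow[symmetric] mult.commute)
  also have "(2 ^ card I) powr q * a powr (2 / ?p) \<le> (2 ^ K * a) powr q * a powr (2 / ?p)"
    using Kr q by (intro mult_right_mono powr_mono2) auto
  also have "\<dots> = (2 ^ K) powr q * (a powr q * a powr (2 / ?p))"
    using a by (simp add: powr_mult)
  also have "a powr q * a powr (2 / ?p) = a\<^sup>2"
    using a by (simp add: powr_add[symmetric] q_def)
  also have "(2 ^ K) powr q * a\<^sup>2 \<le> 4 powr (K * \<rho>) * a\<^sup>2"
  proof (rule mult_right_mono)
    have "(2 ^ K) powr q = (2::real) powr (K * q)"
      by (simp add: powr_powr powr_realpow[symmetric])
    also have "\<dots> \<le> 2 powr (K * (2 * \<rho>))" using q by (intro powr_mono mult_left_mono) auto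
    also have "\<dots> = (2 powr 2) powr (K * \<rho>)" by (simp only: powr_powr mult.left_commute)
    finally show "(2 ^ K) powr q \<le> (4::real) powr (K * \<rho>)" by simp
  qed simp
  finally have "\<rho> ^ l * ?W \<le> 4 powr (K * \<rho>) * a\<^sup>2" .
  then show ?thesis using \<rho> by (simp add: a_def field_simps power_divide)
qed

text \<open>This serves the levels \<open>t * k\<close> with \<open>k > K\<close>, where the choice
  \<open>\<rho> = k / K\<close> would exceed 1.\<close>

lemma fourier_total_le:
  assumes I: "finite I" and A: "A \<subseteq> Pow I" and K: "2 ^ card I \<le> 2 ^ K * card A"
  shows "(\<Sum>S\<in>Pow I. (fourier I (indicator A) S)\<^sup>2) \<le> (real (card A))\<^sup>2 * 2 ^ K"
proof -
  have Kr: "2 ^ card I \<le> 2 ^ K * real (card A)"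
  proof -
    have "real (2 ^ card I) \<le> real (2 ^ K * card A)" using K by (rule of_nat_mono)
    then show ?thesis by simp
  qed
  have "(\<Sum>X\<in>Pow I. (indicator A X)\<^sup>2) = (\<Sum>X\<in>Pow I. indicator A X :: real)"
    by (intro sum.cong) (auto simp: indicator_def)
  also have "\<dots> = real (card A)" using I A by (simp add: sum_indicator_Pow)
  finally have "(\<Sum>S\<in>Pow I. (fourier I (indicator A) S)\<^sup>2) = 2 ^ card I * real (card A)"
    using parseval[OF I, of "indicator A"] by simp
  also have "\<dots> \<le> 2 ^ K * real (card A) * real (card A)"
    using Kr by (intro mult_right_mono) auto
  finally show ?thesis by (simp add: power2_eq_square algebra_simps)
qed

section \<open>Partite hypermatchings\<close>

lemma exists_permutes_image_eq:
  assumes "finite U" "s \<subseteq> U" "s' \<subseteq> U" "card s = card s'"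
  shows "\<exists>\<tau>. \<tau> permutes U \<and> \<tau> ` s = s'"
proof -
  have fin: "finite s" "finite s'" using assms finite_subset by auto
  obtain f where f: "bij_betw f s s'"
    using assms fin finite_same_card_bij by blast
  have "card (U - s) = card (U - s')" using assms fin by (simp add: card_Diff_subset)
  then obtain g where g: "bij_betw g (U - s) (U - s')"
    using assms finite_same_card_bij[of "U - s" "U - s'"] by auto
  define \<tau> where "\<tau> x = (if x \<in> s then f x else if x \<in> U then g x else x)" for x
  have 1: "bij_betw \<tau> s s'" using f by (rule bij_betw_cong[THEN iffD1, rotated]) (simp add: \<tau>_def)
  have 2: "bij_betw \<tau> (U - s) (U - s')"
    using g by (rule bij_betw_cong[THEN iffD1, rotated]) (simp add: \<tau>_def)
  have "bij_betw \<tau> (s \<union> (U - s)) (s' \<union> (U - s'))"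
    using 1 2 by (rule bij_betw_combine) auto
  then have "bij_betw \<tau> U U" using assms by (simp add: Un_absorb1)
  then have "\<tau> permutes U" using assms(2) by (intro bij_imp_permutes) (auto simp: \<tau>_def)
  then show ?thesis using 1 by (auto simp: bij_betw_def)
qed

text \<open>Double counting: composition with a permutation taking one possible image of
  \<open>s\<close> to another shows that all images are attained equally often.\<close>

lemma card_permutes_image_eq:
  fixes U :: "'a set"
  assumes U: "finite U" and s: "s \<subseteq> U" and s': "s' \<subseteq> U" "card s' = card s"
  shows "card {p. p permutes U \<and> p ` s = s'} * (card U choose card s) = fact (card U)"
proof -
  let ?P = "{p. p permutes U}"
  let ?R = "{S. S \<subseteq> U \<and> card S = card s}"
  let ?c = "\<lambda>S. card {p \<in> ?P. p ` s = S}"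
  have fin: "finite ?P" using U by (rule finite_permutations)
  have le: "?c S \<le> ?c S'" if SR: "S \<in> ?R" "S' \<in> ?R" for S S'
  proof -
    have "\<exists>\<tau>. \<tau> permutes U \<and> \<tau> ` S = S'"
      using SR by (intro exists_permutes_image_eq U) auto
    then obtain \<tau> where \<tau>: "\<tau> permutes U" "\<tau> ` S = S'" by (elim exE conjE)
    have inj: "inj_on ((\<circ>) \<tau>) {p \<in> ?P. p ` s = S}"
      using fun.inj_map[OF permutes_inj[OF \<tau>(1)]] by (rule inj_on_subset) simp
    have "\<tau> \<circ> p \<in> {p \<in> ?P. p ` s = S'}" if "p \<in> {p \<in> ?P. p ` s = S}" for p
      using that \<tau> permutes_compose[of p U \<tau>] image_comp[of \<tau> p s] by auto
    then have sub: "(\<circ>) \<tau> ` {p \<in> ?P. p ` s = S} \<subseteq> {p \<in> ?P. p ` s = S'}"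
      by (rule image_subsetI)
    show ?thesis using fin by (intro card_inj_on_le[OF inj sub]) simp
  qed
  have fR: "finite ?R" using U by auto
  have "fact (card U) = card ?P" using U by (simp add: card_permutations)
  also have "\<dots> = (\<Sum>p\<in>?P. 1)" by simp
  also have "\<dots> = (\<Sum>S\<in>?R. of_nat (?c S) * 1)"
  proof (rule sum_fun_comp[OF fin fR, of "\<lambda>p. p ` s" "\<lambda>_. 1 :: nat"])
    show "(\<lambda>p. p ` s) ` ?P \<subseteq> ?R"
      using s by (auto simp: permutes_in_image card_image inj_on_subset[OF permutes_inj])
  qed
  also have "\<dots> = (\<Sum>S\<in>?R. ?c s')"
  proof (intro sum.cong refl)
    fix S assume "S \<in> ?R"
    then have "?c S = ?c s'" using s' by (intro antisym le) auto
    then show "of_nat (?c S) * 1 = ?c s'" by simp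
  qed
  also have "\<dots> = ?c s' * (card U choose card s)"
    using U by (simp add: n_subsets)
  finally show ?thesis by simp
qed

section \<open>Random matchings and parities along hyperedges\<close>

text \<open>The permutations act on all \<open>m\<close> positions although Bob holds only the
  hyperedges below \<open>N\<close>. Thus every position lies on a unique hyperedge, by which
  Alice's edges can be indexed.\<close>

definition matchings :: "nat \<Rightarrow> nat \<Rightarrow> (nat \<Rightarrow> nat \<Rightarrow> nat) set" where
  "matchings t m = (\<Pi>\<^sub>E j\<in>{..<t}. {p. p permutes {..<m}})"

text \<open>The \<open>e\<close>-th hyperedge of the matching \<open>\<sigma>\<close> is \<open>{(j, \<sigma> j e) | j. j < t}\<close>.\<close>

definition hyperedges :: "nat \<Rightarrow> (nat \<Rightarrow> nat \<Rightarrow> nat) \<Rightarrow> nat set \<Rightarrow> (nat \<times> nat) set" where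
  "hyperedges t \<sigma> s = (SIGMA j:{..<t}. \<sigma> j ` s)"

text \<open>Bob's labels are encoded as sets of hyperedges as well; the two promised cases are this
  set and its complement in \<open>{..<N}\<close>.\<close>

definition odd_hyperedges ::
    "nat \<Rightarrow> nat \<Rightarrow> (nat \<Rightarrow> nat \<Rightarrow> nat) \<Rightarrow> (nat \<times> nat) set \<Rightarrow> nat set" where
  "odd_hyperedges t N \<sigma> X = {e\<in>{..<N}. odd (card {j\<in>{..<t}. (j, \<sigma> j e) \<in> X})}"

lemma finite_matchings: "finite (matchings t m)"
  unfolding matchings_def by (intro finite_PiE) (auto simp: finite_permutations)

lemma card_matchings: "card (matchings t m) = fact m ^ t"
  unfolding matchings_def by (simp add: card_PiE card_permutations)

lemma matchings_permutes: "\<sigma> \<in> matchings t m \<Longrightarrow> j < t \<Longrightarrow> \<sigma> j permutes {..<m}"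
  by (auto simp: matchings_def PiE_def)

lemma card_hyperedges:
  assumes "\<sigma> \<in> matchings t m" "finite s"
  shows "card (hyperedges t \<sigma> s) = t * card s"
proof -
  have "card (\<sigma> j ` s) = card s" if "j < t" for j
    using matchings_permutes[OF assms(1) that]
    by (intro card_image) (auto intro: inj_on_subset dest: permutes_inj)
  then show ?thesis using assms by (simp add: hyperedges_def card_SigmaI)
qed

lemma hyperedges_subset:
  assumes "\<sigma> \<in> matchings t m" "s \<subseteq> {..<m}"
  shows "hyperedges t \<sigma> s \<subseteq> {..<t} \<times> {..<m}"
  using assms matchings_permutes permutes_in_image[of _ "{..<m}"]
  by (fastforce simp: hyperedges_def)

text \<open>The hyperedges are disjoint, so the parities along those in \<open>s\<close> multiply to
  the parity of \<open>X\<close> on their union. This transfers Fourier coefficients from the cube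
  of labels to the cube of inputs.\<close>

lemma walsh_odd_hyperedges:
  assumes \<sigma>: "\<sigma> \<in> matchings t m" and s: "s \<subseteq> {..<N}"
  shows "walsh s (odd_hyperedges t N \<sigma> X) = walsh (hyperedges t \<sigma> s) X"
proof -
  let ?d = "\<lambda>e. card {j\<in>{..<t}. (j, \<sigma> j e) \<in> X}"
  have fin: "finite s" using s finite_subset by auto
  have "walsh s (odd_hyperedges t N \<sigma> X) = (\<Prod>e\<in>s \<inter> {e. odd (?d e)}. -1)"
  proof -
    have "s \<inter> odd_hyperedges t N \<sigma> X = s \<inter> {e. odd (?d e)}"
      using s by (auto simp: odd_hyperedges_def)
    then show ?thesis by (simp add: walsh_def)
  qed
  also have "\<dots> = (\<Prod>e\<in>s. if odd (?d e) then -1 else 1)"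
    using fin by (simp add: prod.inter_filter[symmetric] Int_def)
  also have "\<dots> = (\<Prod>e\<in>s. (-1) ^ ?d e)" by (intro prod.cong) auto
  also have "\<dots> = (-1) ^ (\<Sum>e\<in>s. ?d e)" by (simp add: power_sum)
  also have "(\<Sum>e\<in>s. ?d e) = card (SIGMA e:s. {j\<in>{..<t}. (j, \<sigma> j e) \<in> X})"
    using fin by (simp add: card_SigmaI)
  also have "\<dots> = card (hyperedges t \<sigma> s \<inter> X)"
  proof (rule bij_betw_same_card)
    show "bij_betw (\<lambda>(e, j). (j, \<sigma> j e)) (SIGMA e:s. {j\<in>{..<t}. (j, \<sigma> j e) \<in> X})
        (hyperedges t \<sigma> s \<inter> X)"
      using permutes_inj[OF matchings_permutes[OF \<sigma>]]
      by (force simp: bij_betw_def hyperedges_def inj_on_def)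
  qed
  finally show ?thesis by (simp add: walsh_def)
qed

text \<open>For a random matching, the positions covered by \<open>s\<close> form independent
  uniform sets of size \<open>card s\<close>, one in each of the \<open>t\<close> parts. A given
  \<open>S\<close> is therefore hit with probability at most
  \<open>1 / (m choose card s) ^ t\<close>, and with probability zero if its slices have unequal
  sizes.\<close>

lemma sum_matchings_le:
  fixes h :: "(nat \<times> nat) set \<Rightarrow> real"
  assumes s: "s \<subseteq> {..<m}" and h: "\<And>S. h S \<ge> 0"
  shows "(\<Sum>\<sigma>\<in>matchings t m. h (hyperedges t \<sigma> s)) \<le>
    card (matchings t m) / real (m choose card s) ^ t *
      (\<Sum>S | S \<subseteq> {..<t} \<times> {..<m} \<and> card S = t * card s. h S)"
proof -
  let ?R = "{S. S \<subseteq> {..<t} \<times> {..<m} \<and> card S = t * card s}"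
  let ?b = "m choose card s"
  have "card s \<le> m" using s card_mono[of "{..<m}" s] by simp
  then have b: "?b > 0" by simp
  have fR: "finite ?R" by (rule finite_subset[of _ "Pow ({..<t} \<times> {..<m})"]) auto
  have "(\<Sum>\<sigma>\<in>matchings t m. h (hyperedges t \<sigma> s)) =
      (\<Sum>S\<in>?R. real (card {\<sigma>\<in>matchings t m. hyperedges t \<sigma> s = S}) * h S)"
  proof (intro sum_fun_comp[OF finite_matchings fR] image_subsetI)
    fix \<sigma> assume "\<sigma> \<in> matchings t m"
    then show "hyperedges t \<sigma> s \<in> ?R"
      using hyperedges_subset[OF _ s] card_hyperedges finite_subset[OF s] by simp
  qed
  also have "\<dots> \<le> (\<Sum>S\<in>?R. card (matchings t m) / real ?b ^ t * h S)"
  proof (intro sum_mono mult_right_mono h)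
    fix S assume "S \<in> ?R"
    let ?Q = "\<lambda>j. {p. p permutes {..<m} \<and> p ` s = S `` {j}}"
    \<comment> \<open>Fixing \<open>S\<close> prescribes the image of \<open>s\<close> in each part
      separately, so the count factorises.\<close>
    have "{\<sigma>\<in>matchings t m. hyperedges t \<sigma> s = S} \<subseteq> (\<Pi>\<^sub>E j\<in>{..<t}. ?Q j)"
    proof
      fix \<sigma> assume \<sigma>: "\<sigma> \<in> {\<sigma>\<in>matchings t m. hyperedges t \<sigma> s = S}"
      then have "\<sigma> j ` s = S `` {j}" if "j < t" for j
        using that by (auto simp: hyperedges_def)
      then show "\<sigma> \<in> (\<Pi>\<^sub>E j\<in>{..<t}. ?Q j)"
        using \<sigma> by (simp add: matchings_def PiE_iff)
    qed
    moreover have finQ: "finite (?Q j)" for j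
      by (rule finite_subset[OF _ finite_permutations[of "{..<m}"]]) auto
    ultimately have "card {\<sigma>\<in>matchings t m. hyperedges t \<sigma> s = S} \<le> card (\<Pi>\<^sub>E j\<in>{..<t}. ?Q j)"
      by (intro card_mono finite_PiE) auto
    also have "\<dots> = (\<Prod>j<t. card (?Q j))" by (simp add: card_PiE)
    finally have "real (card {\<sigma>\<in>matchings t m. hyperedges t \<sigma> s = S}) \<le> real (\<Prod>j<t. card (?Q j))"
      by (rule of_nat_mono)
    also have "\<dots> = (\<Prod>j<t. real (card (?Q j)))" by (rule of_nat_prod)
    also have "\<dots> \<le> (\<Prod>j<t. fact m / real ?b)"
    proof (intro prod_mono conjI)
      fix j
      show "real (card (?Q j)) \<le> fact m / real ?b"
      proof (cases "?Q j = {}")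
        case False
        then obtain p where "p \<in> ?Q j" by (meson ex_in_conv)
        then have p: "p permutes {..<m}" "p ` s = S `` {j}" by simp_all
        have "p ` s \<subseteq> p ` {..<m}" using s by (rule image_mono)
        then have "S `` {j} \<subseteq> {..<m}" unfolding p(2) permutes_image[OF p(1)] .
        moreover have "card (S `` {j}) = card s"
          using p(1) unfolding p(2)[symmetric]
          by (intro card_image) (auto intro: inj_on_subset dest: permutes_inj)
        ultimately have "card (?Q j) * ?b = fact m"
          using card_permutes_image_eq[of "{..<m}" s "S `` {j}"] s by simp
        then have "real (card (?Q j)) * real ?b = fact m"
          by (simp flip: of_nat_mult)
        then show ?thesis using b by (simp add: field_simps)
      next
        case True
        then have "card (?Q j) = 0" by (simp only: card.empty)
        then show ?thesis by simp
      qed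
    qed simp
    finally show "real (card {\<sigma>\<in>matchings t m. hyperedges t \<sigma> s = S}) \<le> card (matchings t m) / real ?b ^ t"
      by (simp add: card_matchings power_divide)
  qed
  finally show ?thesis by (simp add: sum_distrib_left)
qed

section \<open>The communication bound\<close>

lemma choose_le_choose_middle:
  fixes m :: nat
  assumes "K \<le> k" "k + K \<le> m"
  shows "m choose K \<le> m choose k"
proof (cases "2 * k \<le> m")
  case True
  then show ?thesis using assms by (intro binomial_mono)
next
  case False
  then have "m choose K \<le> m choose (m - k)" using assms by (intro binomial_mono) auto
  then show ?thesis using assms by (simp add: binomial_symmetric[of k m])
qed

text \<open>With \<open>\<rho> = k / K\<close> the level inequality gives
  \<open>(4 * (K / k) ^ t) ^ k\<close>, while the denominator is at least
  \<open>(m / k) ^ (k * (t - 1))\<close>. The assumption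
  \<open>1024 * K ^ t \<le> m ^ (t - 1)\<close> makes the quotient at most
  \<open>(1 / 256) ^ k\<close>, as \<open>1024 = 4 * 256\<close>.\<close>

lemma fourier_level_over_choose_small:
  assumes A: "A \<subseteq> Pow ({..<t} \<times> {..<m})" and dens: "2 ^ (t * m) \<le> 2 ^ K * card A"
    and t: "t \<ge> 1" and k: "1 \<le> k" "k \<le> K" "k \<le> m" and Km: "1024 * K ^ t \<le> m ^ (t - 1)"
  shows "(\<Sum>S | S \<subseteq> {..<t} \<times> {..<m} \<and> card S = t * k.
      (fourier ({..<t} \<times> {..<m}) (indicator A) S)\<^sup>2) / real (m choose k) ^ (t - 1)
    \<le> (real (card A))\<^sup>2 * (1 / 256) ^ k"
proof -
  let ?W = "\<Sum>S | S \<subseteq> {..<t} \<times> {..<m} \<and> card S = t * k.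
      (fourier ({..<t} \<times> {..<m}) (indicator A) S)\<^sup>2"
  let ?b = "real (m choose k) ^ (t - 1)"
  have b: "?b > 0" using k by simp
  have "?W \<le> (real (card A))\<^sup>2 * ((1 / (k / K)) ^ (t * k) * 4 powr (K * (k / K)))"
    using A dens k by (intro fourier_level_le) auto
  also have "(1 / (k / K)) ^ (t * k) * 4 powr (K * (k / K)) = (4 * (K / k) ^ t) ^ k"
    using k by (simp add: powr_realpow power_mult power_mult_distrib)
  also have "\<dots> \<le> (1 / 256 * (m / k) ^ (t - 1)) ^ k"
  proof (rule power_mono)
    have "1024 * real K ^ t \<le> real m ^ (t - 1)"
    proof -
      have "real (1024 * K ^ t) \<le> real (m ^ (t - 1))" using Km by (rule of_nat_mono)
      then show ?thesis by simp
    qed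
    also have "\<dots> \<le> real k * real m ^ (t - 1)" using k by simp
    finally have "1024 * real K ^ t / real k ^ t \<le> real k * real m ^ (t - 1) / real k ^ t"
      by (rule divide_right_mono) simp
    also have "real k ^ t = real k * real k ^ (t - 1)" using t by (cases t) auto
    finally have "1024 * real K ^ t / real k ^ t \<le> real m ^ (t - 1) / real k ^ (t - 1)"
      using k t by (cases t) auto
    then show "4 * (K / k) ^ t \<le> 1 / 256 * (m / k) ^ (t - 1)"
      by (simp add: power_divide)
  qed simp
  also have "\<dots> = (1 / 256) ^ k * ((m / k) ^ k) ^ (t - 1)"
    unfolding power_mult_distrib by (simp add: mult.commute flip: power_mult)
  also have "\<dots> \<le> (1 / 256) ^ k * ?b"
    using k binomial_ge_n_over_k_pow_k[of k m, where 'a = real]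
    by (intro mult_left_mono power_mono) auto
  finally have "?W \<le> (real (card A))\<^sup>2 * ((1 / 256) ^ k * ?b)" by (simp add: mult_left_mono)
  then show ?thesis using b by (simp add: field_simps)
qed

text \<open>The total weight costs a factor \<open>2 ^ K\<close>, which one binomial coefficient
  already outweighs: by unimodality it is at least \<open>m choose K\<close>, hence at least
  \<open>(m / K) ^ K\<close>. The bound \<open>k + K \<le> m\<close> keeps \<open>k\<close> away
  from the upper end, where binomials are small again.\<close>

lemma fourier_level_over_choose_large:
  assumes A: "A \<subseteq> Pow ({..<t} \<times> {..<m})" and dens: "2 ^ (t * m) \<le> 2 ^ K * card A"
    and t: "t \<ge> 2" and k: "K \<le> k" "k + K \<le> m"
  shows "(\<Sum>S | S \<subseteq> {..<t} \<times> {..<m} \<and> card S = t * k.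
      (fourier ({..<t} \<times> {..<m}) (indicator A) S)\<^sup>2) / real (m choose k) ^ (t - 1)
    \<le> (real (card A))\<^sup>2 * (2 * real K / real m) ^ K"
proof -
  let ?I = "{..<t} \<times> {..<m}"
  let ?b = "real (m choose k)"
  have "m choose k > 0" using k by simp
  then have b: "?b \<ge> 1" by linarith
  have "(real m / real K) ^ K \<le> real (m choose K)"
    using k by (intro binomial_ge_n_over_k_pow_k) simp
  also have "\<dots> \<le> ?b" using choose_le_choose_middle[OF k] by simp
  also have "?b \<le> ?b ^ (t - 1)" using b t by (intro self_le_power) auto
  finally have c: "(real m / real K) ^ K \<le> ?b ^ (t - 1)" .
  have pos: "0 < (real m / real K) ^ K" using k by (cases "K = 0") auto
  have "(\<Sum>S | S \<subseteq> ?I \<and> card S = t * k. (fourier ?I (indicator A) S)\<^sup>2) \<le>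
      (\<Sum>S\<in>Pow ?I. (fourier ?I (indicator A) S)\<^sup>2)"
    by (intro sum_mono2) auto
  also have "\<dots> \<le> (real (card A))\<^sup>2 * 2 ^ K"
    using A dens by (intro fourier_total_le) auto
  finally have "(\<Sum>S | S \<subseteq> ?I \<and> card S = t * k. (fourier ?I (indicator A) S)\<^sup>2) / ?b ^ (t - 1)
      \<le> (real (card A))\<^sup>2 * 2 ^ K / (real m / real K) ^ K"
    using c pos by (intro frac_le) auto
  also have "\<dots> = (real (card A))\<^sup>2 * (2 * real K / real m) ^ K"
    by (simp add: power_divide power_mult_distrib)
  finally show ?thesis .
qed

text \<open>The small levels form a geometric series of sum at most 1/128. The others number at most
  \<open>m\<close> and contribute at most 1/256 in total.\<close>

lemma sum_fourier_level_over_choose_le: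
  assumes A: "A \<subseteq> Pow ({..<t} \<times> {..<m})" and dens: "2 ^ (t * m) \<le> 2 ^ K * card A"
    and t: "t \<ge> 2" and NK: "N + K \<le> m"
    and Km: "1024 * K ^ t \<le> m ^ (t - 1)" "real m * (2 * real K / real m) ^ K \<le> 1 / 256"
  shows "(\<Sum>k=1..N. (\<Sum>S | S \<subseteq> {..<t} \<times> {..<m} \<and> card S = t * k.
      (fourier ({..<t} \<times> {..<m}) (indicator A) S)\<^sup>2) / real (m choose k) ^ (t - 1))
    \<le> (real (card A))\<^sup>2 / 64"
proof -
  let ?a = "(real (card A))\<^sup>2"
  let ?r = "(2 * real K / real m) ^ K"
  have r: "?r \<ge> 0" by simp
  have "(\<Sum>k=1..N. (\<Sum>S | S \<subseteq> {..<t} \<times> {..<m} \<and> card S = t * k.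
      (fourier ({..<t} \<times> {..<m}) (indicator A) S)\<^sup>2) / real (m choose k) ^ (t - 1))
    \<le> (\<Sum>k=1..N. ?a * ((1 / 256) ^ k + ?r))"
  proof (rule sum_mono)
    fix k assume k: "k \<in> {1..N}"
    show "(\<Sum>S | S \<subseteq> {..<t} \<times> {..<m} \<and> card S = t * k.
        (fourier ({..<t} \<times> {..<m}) (indicator A) S)\<^sup>2) / real (m choose k) ^ (t - 1)
      \<le> ?a * ((1 / 256) ^ k + ?r)" (is "?L \<le> _")
    proof (cases "k \<le> K")
      case True
      then have "?L \<le> ?a * (1 / 256) ^ k"
        using A dens t k NK Km by (intro fourier_level_over_choose_small) auto
      also have "\<dots> \<le> ?a * ((1 / 256) ^ k + ?r)" using r by (intro mult_left_mono) auto
      finally show ?thesis .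
    next
      case False
      then have "?L \<le> ?a * ?r"
        using A dens t k NK by (intro fourier_level_over_choose_large) auto
      also have "\<dots> \<le> ?a * ((1 / 256) ^ k + ?r)" by (intro mult_left_mono) auto
      finally show ?thesis .
    qed
  qed
  also have "\<dots> = ?a * ((\<Sum>k=1..N. (1 / 256) ^ k) + N * ?r)"
    by (simp add: sum.distrib flip: sum_distrib_left)
  also have "\<dots> \<le> ?a * (1 / 128 + 1 / 256)"
  proof (intro mult_left_mono add_mono)
    have "(\<Sum>k=1..N. (1 / 256 :: real) ^ k) \<le> (1 / 256 - (1 / 256) ^ Suc N) / (1 - 1 / 256)"
      by (subst sum_gp) auto
    also have "\<dots> \<le> (1 / 256) / (1 - 1 / 256)" by (intro divide_right_mono) auto
    also have "\<dots> \<le> 1 / 128" by simp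
    finally show "(\<Sum>k=1..N. (1 / 256 :: real) ^ k) \<le> 1 / 128" .
    have "N * ?r \<le> m * ?r" using NK r by (intro mult_right_mono) auto
    then show "N * ?r \<le> 1 / 256" using Km by simp
  qed simp
  also have "\<dots> \<le> ?a / 64" by simp
  finally show ?thesis .
qed

section \<open>From Fourier weight to Bob's advantage\<close>

lemma walsh_compl:
  assumes "finite J" "s \<subseteq> J" "w \<subseteq> J"
  shows "walsh s (J - w) = (-1) ^ card s * walsh s w"
proof -
  have "s = (s \<inter> w) \<union> (s \<inter> (J - w))" using assms by auto
  moreover have "finite s" using assms finite_subset by auto
  ultimately have "card s = card (s \<inter> w) + card (s \<inter> (J - w))"
    using card_Un_disjoint[of "s \<inter> w" "s \<inter> (J - w)"] by auto
  then show ?thesis by (simp add: walsh_def power_add)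
qed

text \<open>The advantage is the inner product of Bob's answer \<open>G\<close> with the signed
  count \<open>h\<close> of labels in the two cases, and is bounded by Cauchy-Schwarz and Parseval
  on the label cube. Complementing the labels multiplies the coefficient at \<open>s\<close> by
  \<open>(-1) ^ card s\<close>, so coefficients of even sets cancel and those of odd sets double,
  whence the factor 4.\<close>

lemma matching_advantage_sq_le:
  assumes \<sigma>: "\<sigma> \<in> matchings t m" and A: "A \<subseteq> Pow ({..<t} \<times> {..<m})"
    and G: "\<And>w. \<bar>G w\<bar> \<le> (1 :: real)"
  shows "(\<Sum>X\<in>A. G ({..<N} - odd_hyperedges t N \<sigma> X) - G (odd_hyperedges t N \<sigma> X))\<^sup>2
    \<le> 4 * (\<Sum>s\<in>Pow {..<N} - {{}}. (fourier ({..<t} \<times> {..<m}) (indicator A) (hyperedges t \<sigma> s))\<^sup>2)"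
proof -
  let ?I = "{..<t} \<times> {..<m}" and ?J = "{..<N}"
  let ?M = "odd_hyperedges t N \<sigma>"
  have fA: "finite A" using A finite_subset by auto
  have M: "?M X \<subseteq> ?J" for X by (auto simp: odd_hyperedges_def)
  define h :: "nat set \<Rightarrow> real" where
    "h w = (\<Sum>X\<in>A. of_bool (?J - ?M X = w) - of_bool (?M X = w))" for w
  have h: "(\<Sum>w\<in>Pow ?J. h w * F w) = (\<Sum>X\<in>A. F (?J - ?M X) - F (?M X))" for F
  proof -
    have "(\<Sum>w\<in>Pow ?J. h w * F w) =
      (\<Sum>w\<in>Pow ?J. \<Sum>X\<in>A. (if ?J - ?M X = w then F w else 0) - (if ?M X = w then F w else 0))"
      unfolding h_def sum_distrib_right by (intro sum.cong refl) auto
    also have "\<dots> =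
      (\<Sum>X\<in>A. \<Sum>w\<in>Pow ?J. (if ?J - ?M X = w then F w else 0) - (if ?M X = w then F w else 0))"
      by (rule sum.swap)
    also have "\<dots> = (\<Sum>X\<in>A. F (?J - ?M X) - F (?M X))"
      using M by (intro sum.cong refl) (simp add: sum_subtractf sum.delta')
    finally show ?thesis .
  qed
  have "fourier ?J h s = ((-1) ^ card s - 1) * fourier ?I (indicator A) (hyperedges t \<sigma> s)"
    if s: "s \<in> Pow ?J" for s
  proof -
    have "fourier ?J h s = (\<Sum>X\<in>A. ((-1) ^ card s - 1) * walsh (hyperedges t \<sigma> s) X)"
      unfolding fourier_def h
      using s M by (intro sum.cong refl)
        (simp add: walsh_compl walsh_odd_hyperedges[OF \<sigma>, symmetric] algebra_simps)
    also have "(\<Sum>X\<in>A. ((-1) ^ card s - 1) * walsh (hyperedges t \<sigma> s) X)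
      = ((-1) ^ card s - 1) * (\<Sum>X\<in>Pow ?I. indicator A X * walsh (hyperedges t \<sigma> s) X)"
      unfolding sum_distrib_left using A
      by (intro sum.mono_neutral_cong_left) (auto simp: indicator_def)
    finally show ?thesis by (simp add: fourier_def)
  qed
  then have sq: "(fourier ?J h s)\<^sup>2 \<le>
      (if s = {} then 0 else 4 * (fourier ?I (indicator A) (hyperedges t \<sigma> s))\<^sup>2)"
    if "s \<in> Pow ?J" for s
    using that by (cases "even (card s)") (auto simp: power_mult_distrib)
  have "(\<Sum>X\<in>A. G (?J - ?M X) - G (?M X))\<^sup>2 = (\<Sum>w\<in>Pow ?J. h w * G w)\<^sup>2"
    by (simp only: h)
  also have "\<dots> \<le> (\<Sum>w\<in>Pow ?J. (h w)\<^sup>2) * (\<Sum>w\<in>Pow ?J. (G w)\<^sup>2)"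
    by (rule Cauchy_Schwarz_ineq_sum)
  also have "\<dots> \<le> (\<Sum>w\<in>Pow ?J. (h w)\<^sup>2) * (\<Sum>w\<in>Pow ?J. 1)"
    using G by (intro mult_left_mono sum_mono sum_nonneg) (auto simp: abs_square_le_1)
  \<comment> \<open>The factor \<open>2 ^ N\<close> from the norm of \<open>G\<close> is the one in
    Parseval.\<close>
  also have "\<dots> = (\<Sum>s\<in>Pow ?J. (fourier ?J h s)\<^sup>2)"
    by (simp add: parseval card_Pow)
  also have "\<dots> \<le> (\<Sum>s\<in>Pow ?J. if s = {} then 0 else
      4 * (fourier ?I (indicator A) (hyperedges t \<sigma> s))\<^sup>2)"
    by (intro sum_mono sq)
  also have "\<dots> = 4 * (\<Sum>s\<in>Pow ?J - {{}}. (fourier ?I (indicator A) (hyperedges t \<sigma> s))\<^sup>2)"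
    unfolding sum_distrib_left by (intro sum.mono_neutral_cong_right) auto
  finally show ?thesis .
qed

text \<open>The second moment over the matchings is grouped by \<open>k = card s\<close>. The
  \<open>N choose k\<close> sets of size \<open>k\<close> use up one of the \<open>t\<close> factors
  \<open>m choose k\<close>, leaving the exponent \<open>t - 1\<close>. The second moment is at most
  4/64 of the squared size of \<open>A\<close>, so the mean advantage is at most 1/4 of that
  size.\<close>

lemma sum_matching_advantage_le:
  assumes A: "A \<subseteq> Pow ({..<t} \<times> {..<m})" and dens: "2 ^ (t * m) \<le> 2 ^ K * card A"
    and t: "t \<ge> 2" and NK: "N + K \<le> m"
    and Km: "1024 * K ^ t \<le> m ^ (t - 1)" "real m * (2 * real K / real m) ^ K \<le> 1 / 256"
    and G: "\<And>\<sigma> w. \<bar>G \<sigma> w\<bar> \<le> (1 :: real)"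
  shows "(\<Sum>\<sigma>\<in>matchings t m. \<Sum>X\<in>A.
      G \<sigma> ({..<N} - odd_hyperedges t N \<sigma> X) - G \<sigma> (odd_hyperedges t N \<sigma> X))
    \<le> card (matchings t m) * card A / 4"
proof -
  let ?I = "{..<t} \<times> {..<m}" and ?P = "matchings t m"
  let ?h = "\<lambda>S. (fourier ?I (indicator A) S)\<^sup>2"
  let ?W = "\<lambda>k. \<Sum>S | S \<subseteq> ?I \<and> card S = t * k. ?h S"
  define T where "T \<sigma> = (\<Sum>X\<in>A.
      G \<sigma> ({..<N} - odd_hyperedges t N \<sigma> X) - G \<sigma> (odd_hyperedges t N \<sigma> X))" for \<sigma>
  have W: "?W k \<ge> 0" for k by (intro sum_nonneg) auto
  have "(\<Sum>\<sigma>\<in>?P. (T \<sigma>)\<^sup>2) \<le> (\<Sum>\<sigma>\<in>?P. 4 * (\<Sum>s\<in>Pow {..<N} - {{}}. ?h (hyperedges t \<sigma> s)))"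
    unfolding T_def using A G by (intro sum_mono matching_advantage_sq_le)
  also have "\<dots> = 4 * (\<Sum>s\<in>Pow {..<N} - {{}}. \<Sum>\<sigma>\<in>?P. ?h (hyperedges t \<sigma> s))"
    by (simp add: sum.swap[of _ ?P] flip: sum_distrib_left)
  also have "\<dots> \<le> 4 * (\<Sum>s\<in>Pow {..<N} - {{}}. card ?P / real (m choose card s) ^ t * ?W (card s))"
    using NK by (intro mult_left_mono sum_mono sum_matchings_le) auto
  also have "(\<Sum>s\<in>Pow {..<N} - {{}}. card ?P / real (m choose card s) ^ t * ?W (card s))
      = (\<Sum>k\<in>{1..N}. real (card {s \<in> Pow {..<N} - {{}}. card s = k})
          * (card ?P / real (m choose k) ^ t * ?W k))"
  proof (rule sum_fun_comp)
    show "card ` (Pow {..<N} - {{}}) \<subseteq> {1..N}"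
    proof
      fix k assume "k \<in> card ` (Pow {..<N} - {{}})"
      then obtain s where s: "s \<subseteq> {..<N}" "s \<noteq> {}" "k = card s" by auto
      then have "finite s" using finite_subset by auto
      then show "k \<in> {1..N}" using s card_mono[of "{..<N}" s] by (auto simp: Suc_le_eq card_gt_0_iff)
    qed
  qed auto
  also have "4 * \<dots> \<le> 4 * (\<Sum>k\<in>{1..N}. card ?P * (?W k / real (m choose k) ^ (t - 1)))"
  proof (intro mult_left_mono sum_mono)
    fix k assume k: "k \<in> {1..N}"
    then have b: "m choose k > 0" using NK by simp
    have "{s \<in> Pow {..<N} - {{}}. card s = k} = {s. s \<subseteq> {..<N} \<and> card s = k}"
      using k by auto
    then have "card {s \<in> Pow {..<N} - {{}}. card s = k} = N choose k"
      by (simp add: n_subsets)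
    also have "\<dots> \<le> m choose k" using NK by (intro binomial_right_mono) auto
    finally have "real (card {s \<in> Pow {..<N} - {{}}. card s = k}) * (card ?P / real (m choose k) ^ t * ?W k)
        \<le> real (m choose k) * (card ?P / real (m choose k) ^ t * ?W k)"
      using W by (intro mult_right_mono mult_nonneg_nonneg) auto
    also have "\<dots> = card ?P * (?W k / real (m choose k) ^ (t - 1))"
      using b t by (cases t) auto
    finally show "real (card {s \<in> Pow {..<N} - {{}}. card s = k}) * (card ?P / real (m choose k) ^ t * ?W k)
        \<le> card ?P * (?W k / real (m choose k) ^ (t - 1))" .
  qed simp
  also have "\<dots> \<le> 4 * (card ?P * ((real (card A))\<^sup>2 / 64))"
    unfolding sum_distrib_left[symmetric]
    using sum_fourier_level_over_choose_le[OF A dens t NK Km] by (intro mult_left_mono) auto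
  finally have TT: "(\<Sum>\<sigma>\<in>?P. (T \<sigma>)\<^sup>2) \<le> card ?P * (real (card A))\<^sup>2 / 16" by simp
  have "(\<Sum>\<sigma>\<in>?P. T \<sigma> * 1)\<^sup>2 \<le> (\<Sum>\<sigma>\<in>?P. (T \<sigma>)\<^sup>2) * (\<Sum>\<sigma>\<in>?P. 1\<^sup>2)"
    by (rule Cauchy_Schwarz_ineq_sum)
  also have "\<dots> \<le> card ?P * (real (card A))\<^sup>2 / 16 * card ?P"
    using TT by (simp add: mult_right_mono del: times_divide_eq_left)
  also have "\<dots> = (card ?P * card A / 4)\<^sup>2" by (simp add: power2_eq_square)
  finally have "(\<Sum>\<sigma>\<in>?P. T \<sigma> * 1) \<le> card ?P * card A / 4" by (rule power2_le_imp_le) simp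
  then show ?thesis by (simp only: T_def mult_1_right)
qed

text \<open>The inputs are partitioned by message. Dense classes have mean advantage at most 1/4.
  Each sparse class contains less than a fraction \<open>1 / 2 ^ K\<close> of the inputs, so with at
  most \<open>2 ^ K / 8\<close> messages they add at most 1/8. Guessing contributes 1 to the sum of
  the two success rates, and \<open>1 + 1/4 + 1/8 = 11/8\<close>.\<close>

theorem hidden_matching_protocol_success_le:
  fixes msg :: "(nat \<times> nat) set \<Rightarrow> 'b" and g :: "'b \<Rightarrow> (nat \<Rightarrow> nat \<Rightarrow> nat) \<Rightarrow> nat set \<Rightarrow> bool"
  assumes t: "t \<ge> 2" and NK: "N + K \<le> m"
    and Km: "1024 * K ^ t \<le> m ^ (t - 1)" "real m * (2 * real K / real m) ^ K \<le> 1 / 256"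
    and msg: "8 * card (msg ` Pow ({..<t} \<times> {..<m})) \<le> 2 ^ K"
  shows "(\<Sum>X\<in>Pow ({..<t} \<times> {..<m}). \<Sum>\<sigma>\<in>matchings t m.
      of_bool (g (msg X) \<sigma> ({..<N} - odd_hyperedges t N \<sigma> X)) +
      of_bool (\<not> g (msg X) \<sigma> (odd_hyperedges t N \<sigma> X)))
    \<le> (11 / 8 :: real) * card (Pow ({..<t} \<times> {..<m}) \<times> matchings t m)"
proof -
  let ?U = "Pow ({..<t} \<times> {..<m})" and ?P = "matchings t m"
  define G :: "'b \<Rightarrow> (nat \<Rightarrow> nat \<Rightarrow> nat) \<Rightarrow> nat set \<Rightarrow> real" where
    "G \<mu> \<sigma> w = of_bool (g \<mu> \<sigma> w)" for \<mu> \<sigma> w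
  have G: "\<bar>G \<mu> \<sigma> w\<bar> \<le> 1" "G \<mu> \<sigma> w \<ge> 0" "G \<mu> \<sigma> w \<le> 1" for \<mu> \<sigma> w by (auto simp: G_def)
  define D where "D \<mu> \<sigma> X =
      G \<mu> \<sigma> ({..<N} - odd_hyperedges t N \<sigma> X) - G \<mu> \<sigma> (odd_hyperedges t N \<sigma> X)" for \<mu> \<sigma> X
  define A where "A \<mu> = {X\<in>?U. msg X = \<mu>}" for \<mu>
  have fU: "finite ?U" by simp
  have cU: "real (card ?U) = 2 ^ (t * m)" by (simp add: card_Pow)
  have fA: "finite (A \<mu>)" and subA: "A \<mu> \<subseteq> ?U" for \<mu> by (auto simp: A_def)
  have cA: "(\<Sum>\<mu>\<in>msg ` ?U. real (card (A \<mu>))) = card ?U"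
    using sum.image_gen[OF fU, of "\<lambda>_. 1 :: real" msg] by (simp add: A_def)
  have D1: "(\<Sum>X\<in>A \<mu>. \<Sum>\<sigma>\<in>?P. D \<mu> \<sigma> X) \<le>
      card ?P * card (A \<mu>) / 4 + card ?P * (2 ^ (t * m) / 2 ^ K)" for \<mu>
  proof (cases "2 ^ (t * m) \<le> 2 ^ K * card (A \<mu>)")
    case True
    have "(\<Sum>\<sigma>\<in>?P. \<Sum>X\<in>A \<mu>. D \<mu> \<sigma> X) \<le> card ?P * card (A \<mu>) / 4"
      unfolding D_def using subA True t NK Km G by (intro sum_matching_advantage_le)
    also have "\<dots> \<le> card ?P * card (A \<mu>) / 4 + card ?P * (2 ^ (t * m) / 2 ^ K)" by simp
    finally show ?thesis by (subst sum.swap)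
  next
    case False
    then have "real (2 ^ K * card (A \<mu>)) \<le> real (2 ^ (t * m))" by (intro of_nat_mono) simp
    then have c: "real (card (A \<mu>)) \<le> 2 ^ (t * m) / 2 ^ K" by (simp add: field_simps)
    have "(\<Sum>X\<in>A \<mu>. \<Sum>\<sigma>\<in>?P. D \<mu> \<sigma> X) \<le> (\<Sum>X\<in>A \<mu>. \<Sum>\<sigma>\<in>?P. 1)"
    proof (intro sum_mono)
      fix X \<sigma>
      show "D \<mu> \<sigma> X \<le> 1" unfolding D_def
        using G(3)[of \<mu> \<sigma> "{..<N} - odd_hyperedges t N \<sigma> X"] G(2)[of \<mu> \<sigma> "odd_hyperedges t N \<sigma> X"]
        by linarith
    qed
    also have "\<dots> = card ?P * real (card (A \<mu>))" by simp
    also have "\<dots> \<le> card ?P * (2 ^ (t * m) / 2 ^ K)" using c by (intro mult_left_mono) auto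
    also have "\<dots> \<le> card ?P * card (A \<mu>) / 4 + card ?P * (2 ^ (t * m) / 2 ^ K)" by simp
    finally show ?thesis .
  qed
  have "(\<Sum>X\<in>?U. \<Sum>\<sigma>\<in>?P. of_bool (g (msg X) \<sigma> ({..<N} - odd_hyperedges t N \<sigma> X)) +
      of_bool (\<not> g (msg X) \<sigma> (odd_hyperedges t N \<sigma> X))) = (\<Sum>X\<in>?U. \<Sum>\<sigma>\<in>?P. 1 + D (msg X) \<sigma> X)"
    by (intro sum.cong refl) (auto simp: D_def G_def)
  also have "\<dots> = card (?U \<times> ?P) + (\<Sum>X\<in>?U. \<Sum>\<sigma>\<in>?P. D (msg X) \<sigma> X)"
    by (simp add: sum.distrib card_cartesian_product)
  also have "(\<Sum>X\<in>?U. \<Sum>\<sigma>\<in>?P. D (msg X) \<sigma> X) = (\<Sum>\<mu>\<in>msg ` ?U. \<Sum>X\<in>A \<mu>. \<Sum>\<sigma>\<in>?P. D \<mu> \<sigma> X)"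
    unfolding sum.image_gen[OF fU, of "\<lambda>X. \<Sum>\<sigma>\<in>?P. D (msg X) \<sigma> X" msg]
    by (intro sum.cong refl) (auto simp: A_def)
  also have "\<dots> \<le> (\<Sum>\<mu>\<in>msg ` ?U. card ?P * card (A \<mu>) / 4 + card ?P * (2 ^ (t * m) / 2 ^ K))"
    by (intro sum_mono D1)
  also have "\<dots> = card ?P / 4 * (\<Sum>\<mu>\<in>msg ` ?U. real (card (A \<mu>)))
      + card (msg ` ?U) * (card ?P * (2 ^ (t * m) / 2 ^ K))"
    by (simp add: sum.distrib sum_distrib_left)
  also have "\<dots> = card (?U \<times> ?P) * (1 / 4 + card (msg ` ?U) / 2 ^ K)"
    unfolding cA card_cartesian_product by (simp add: cU algebra_simps)
  also have "\<dots> \<le> card (?U \<times> ?P) * (1 / 4 + 1 / 8)"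
  proof (intro mult_left_mono add_left_mono)
    have "real (8 * card (msg ` ?U)) \<le> real (2 ^ K)" using msg by (rule of_nat_mono)
    then show "card (msg ` ?U) / 2 ^ K \<le> (1 / 8 :: real)" by (simp add: field_simps)
  qed simp
  finally show ?thesis by simp
qed

section \<open>The gadget graph\<close>

text \<open>Level \<open>2 * t - 1\<close> is identified with level \<open>0\<close>, which consists of the two hub vertices only.\<close>

definition vertex :: "nat \<Rightarrow> nat \<Rightarrow> nat \<Rightarrow> bool \<Rightarrow> nat \<times> nat \<times> bool" where
  "vertex t p i b = (if p = 0 \<or> p = 2 * t - 1 then (0, 0, b) else (p, i, b))"

definition vertices :: "nat \<Rightarrow> nat \<Rightarrow> (nat \<times> nat \<times> bool) set" where
  "vertices t m = {0} \<times> {0} \<times> UNIV \<union> {1..<2 * t - 1} \<times> {..<m} \<times> UNIV"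

definition alice_edge :: "nat \<Rightarrow> (nat \<times> nat) set \<Rightarrow> nat \<times> nat \<times> bool \<Rightarrow> (nat \<times> nat \<times> bool) set" where
  "alice_edge t X = (\<lambda>(j, i, b). {vertex t (2 * j) i b, vertex t (2 * j + 1) i (b \<noteq> ((j, i) \<in> X))})"

text \<open>Only the first of Bob's \<open>t - 1\<close> layers carries the labels; the others just
  link consecutive positions of a hyperedge.\<close>

definition bob_edge ::
    "nat \<Rightarrow> (nat \<Rightarrow> nat \<Rightarrow> nat) \<Rightarrow> nat set \<Rightarrow> nat \<times> nat \<times> bool \<Rightarrow> (nat \<times> nat \<times> bool) set" where
  "bob_edge t \<sigma> W = (\<lambda>(j, e, b). {vertex t (2 * j + 1) (\<sigma> j e) b,
     vertex t (2 * j + 2) (\<sigma> (j + 1) e) (b \<noteq> (j = 0 \<and> e \<in> W))})"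

text \<open>This half of the stream depends on \<open>X\<close> alone and Bob's half on the matching
  and labels alone, so the memory between them is a one-way message.\<close>

definition alice_stream :: "nat \<Rightarrow> nat \<Rightarrow> (nat \<times> nat) set \<Rightarrow> (nat \<times> nat \<times> bool) set list" where
  "alice_stream t m X = map (alice_edge t X)
     (List.product [0..<t] (List.product [0..<m] [False, True]))"

definition bob_stream ::
    "nat \<Rightarrow> nat \<Rightarrow> (nat \<Rightarrow> nat \<Rightarrow> nat) \<Rightarrow> nat set \<Rightarrow> (nat \<times> nat \<times> bool) set list" where
  "bob_stream t N \<sigma> W = map (bob_edge t \<sigma> W)
     (List.product [0..<t - 1] (List.product [0..<N] [False, True]))"

text \<open>
  The edges of Alice and Bob together, indexed by the lower level \<open>l\<close> and the hyperedge \<open>e\<close>: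
  the even levels are Alice's, the odd ones Bob's.
\<close>

definition turn :: "(nat \<Rightarrow> nat \<Rightarrow> nat) \<Rightarrow> (nat \<times> nat) set \<Rightarrow> nat set \<Rightarrow> nat \<Rightarrow> nat \<Rightarrow> bool" where
  "turn \<sigma> X W e l = (if even l then (l div 2, \<sigma> (l div 2) e) \<in> X else l = 1 \<and> e \<in> W)"

definition step :: "nat \<Rightarrow> (nat \<Rightarrow> nat \<Rightarrow> nat) \<Rightarrow> (nat \<times> nat) set \<Rightarrow> nat set \<Rightarrow>
    nat \<times> nat \<times> bool \<Rightarrow> (nat \<times> nat \<times> bool) set" where
  "step t \<sigma> X W = (\<lambda>(l, e, b). {vertex t l (\<sigma> (l div 2) e) b,
     vertex t (Suc l) (\<sigma> (Suc l div 2) e) (b \<noteq> turn \<sigma> X W e l)})"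

text \<open>Alice draws edges at all \<open>m\<close> positions, since she does not know which ones
  lie on Bob's \<open>N\<close> hyperedges.\<close>

definition steps :: "nat \<Rightarrow> nat \<Rightarrow> nat \<Rightarrow> (nat \<times> nat \<times> bool) set" where
  "steps t m N = {(l, e, b). l < 2 * t - 1 \<and> e < (if even l then m else N)}"

definition total_turn ::
    "(nat \<Rightarrow> nat \<Rightarrow> nat) \<Rightarrow> (nat \<times> nat) set \<Rightarrow> nat set \<Rightarrow> nat \<Rightarrow> nat \<Rightarrow> bool" where
  "total_turn \<sigma> X W e l = odd (card {l'. l' < l \<and> turn \<sigma> X W e l'})"

section \<open>Turns along a walk and the number of edges\<close>

lemma total_turn_0 [simp]: "\<not> total_turn \<sigma> X W e 0"
  by (simp add: total_turn_def)

lemma total_turn_Suc [simp]: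
  "total_turn \<sigma> X W e (Suc l) = (total_turn \<sigma> X W e l \<noteq> turn \<sigma> X W e l)"
proof -
  have "{l'. l' < Suc l \<and> turn \<sigma> X W e l'} =
      {l'. l' < l \<and> turn \<sigma> X W e l'} \<union> (if turn \<sigma> X W e l then {l} else {})"
    by (auto simp: less_Suc_eq)
  then show ?thesis by (auto simp: total_turn_def)
qed

text \<open>A full walk meets the \<open>t\<close> bits on even levels and the label on level 1, so
  it closes up exactly when label and parity agree.\<close>

lemma total_turn_hub:
  assumes "t \<ge> 2"
  shows "total_turn \<sigma> X W e (2 * t - 1) =
    (odd (card {j\<in>{..<t}. (j, \<sigma> j e) \<in> X}) \<noteq> (e \<in> W))"
proof -
  let ?A = "{j\<in>{..<t}. (j, \<sigma> j e) \<in> X}"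
  let ?B = "if e \<in> W then {1} else {} :: nat set"
  have "{l'. l' < 2 * t - 1 \<and> turn \<sigma> X W e l'} = (\<lambda>j. 2 * j) ` ?A \<union> ?B"
    using assms by (auto simp: turn_def elim!: evenE)
  moreover have "card ((\<lambda>j. 2 * j) ` ?A \<union> ?B) = card ((\<lambda>j. 2 * j) ` ?A) + card ?B"
    by (intro card_Un_disjoint) auto
  moreover have "card ((\<lambda>j. 2 * j) ` ?A) = card ?A"
    by (intro card_image) (auto simp: inj_on_def)
  ultimately show ?thesis by (simp add: total_turn_def)
qed

lemma finite_vertices: "finite (vertices t m)"
  by (simp add: vertices_def)

lemma card_vertices: "card (vertices t m) = 2 + (2 * t - 2) * m * 2"
  unfolding vertices_def
  by (subst card_Un_disjoint) (auto simp: card_cartesian_product)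

lemma finite_steps: "finite (steps t m N)"
  by (rule finite_subset[of _ "{..<2 * t - 1} \<times> {..<max m N} \<times> UNIV"])
    (auto simp: steps_def split: if_splits)

lemma card_steps:
  assumes "t \<ge> 1"
  shows "card (steps t m N) = t * (m * 2) + (t - 1) * (N * 2)"
proof -
  let ?f = "\<lambda>(j, i, b). (2 * j :: nat, i :: nat, b :: bool)"
  let ?g = "\<lambda>(j, i, b). (2 * j + 1 :: nat, i :: nat, b :: bool)"
  let ?A = "{..<t} \<times> {..<m} \<times> (UNIV :: bool set)"
  let ?B = "{..<t - 1} \<times> {..<N} \<times> (UNIV :: bool set)"
  have "steps t m N = ?f ` ?A \<union> ?g ` ?B"
  proof (intro set_eqI iffI)
    fix x assume x: "x \<in> steps t m N"
    obtain l e b where lb: "x = (l, e, b)" by (cases x)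
    show "x \<in> ?f ` ?A \<union> ?g ` ?B"
    proof (cases "even l")
      case True
      then have "x = ?f (l div 2, e, b)" "(l div 2, e, b) \<in> ?A" using x lb by (auto simp: steps_def)
      then show ?thesis by blast
    next
      case False
      then have "x = ?g (l div 2, e, b)" "(l div 2, e, b) \<in> ?B"
        using x lb by (auto simp: steps_def elim!: oddE)
      then show ?thesis by blast
    qed
  next
    fix x assume "x \<in> ?f ` ?A \<union> ?g ` ?B"
    then show "x \<in> steps t m N" using assms by (auto simp: steps_def)
  qed
  moreover have "card (?f ` ?A) = card ?A" by (intro card_image) (auto simp: inj_on_def)
  moreover have "card (?g ` ?B) = card ?B" by (intro card_image) (auto simp: inj_on_def)
  moreover have "?f ` ?A \<inter> ?g ` ?B = {}"
  proof -
    have "2 * i \<noteq> Suc (2 * j)" for i j :: nat by presburger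
    then show ?thesis by auto
  qed
  ultimately show ?thesis
    by (simp add: card_Un_disjoint card_cartesian_product)
qed

lemma vertex_in_vertices: "p \<le> 2 * t - 1 \<Longrightarrow> i < m \<Longrightarrow> vertex t p i b \<in> vertices t m"
  by (auto simp: vertex_def vertices_def)

section \<open>Simplicity, odd closed walks and two-colourings of the gadget\<close>

locale hidden_matching_graph =
  fixes t m N :: nat and \<sigma> :: "nat \<Rightarrow> nat \<Rightarrow> nat"
  assumes t: "t \<ge> 2" and Nm: "N \<le> m" and \<sigma>: "\<sigma> \<in> matchings t m"
begin

lemma sigma_lt: "j < t \<Longrightarrow> e < m \<Longrightarrow> \<sigma> j e < m"
  using matchings_permutes[OF \<sigma>] permutes_in_image[of "\<sigma> j" "{..<m}" e] by simp

lemma sigma_inj: "j < t \<Longrightarrow> \<sigma> j e = \<sigma> j e' \<Longrightarrow> e = e'"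
  using matchings_permutes[OF \<sigma>] permutes_inj by (metis injD)

lemma step_vertices:
  assumes "(l, e, b) \<in> steps t m N"
  shows "vertex t l (\<sigma> (l div 2) e) b \<in> vertices t m"
    "vertex t (Suc l) (\<sigma> (Suc l div 2) e) c \<in> vertices t m"
    "vertex t l (\<sigma> (l div 2) e) b \<noteq> vertex t (Suc l) (\<sigma> (Suc l div 2) e) c"
proof -
  have l: "l < 2 * t - 1" and "e < m" using assms Nm by (auto simp: steps_def split: if_splits)
  then show "vertex t l (\<sigma> (l div 2) e) b \<in> vertices t m"
    "vertex t (Suc l) (\<sigma> (Suc l div 2) e) c \<in> vertices t m"
    by (auto intro!: vertex_in_vertices sigma_lt)
  show "vertex t l (\<sigma> (l div 2) e) b \<noteq> vertex t (Suc l) (\<sigma> (Suc l div 2) e) c"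
    using l t by (auto simp: vertex_def)
qed

lemma step_edge:
  assumes "x \<in> steps t m N"
  shows "step t \<sigma> X W x \<subseteq> vertices t m \<and> card (step t \<sigma> X W x) = 2"
  using assms step_vertices by (cases x) (auto simp: step_def)

lemma inj_on_step: "inj_on (step t \<sigma> X W) (steps t m N)"
proof (rule inj_onI)
  fix x x' assume x: "x \<in> steps t m N" and x': "x' \<in> steps t m N"
    and eq: "step t \<sigma> X W x = step t \<sigma> X W x'"
  obtain l e b where lb: "x = (l, e, b)" by (cases x)
  obtain l' e' b' where lb': "x' = (l', e', b')" by (cases x')
  have l: "l < 2 * t - 1" "l' < 2 * t - 1" using x x' lb lb' by (auto simp: steps_def)
  define nxt where "nxt l = (if Suc l = 2 * t - 1 then 0 else Suc l)" for l
  have levels: "fst ` step t \<sigma> X W (l, e, b) = {l, nxt l}" if "l < 2 * t - 1" for l e b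
    using that by (auto simp: step_def vertex_def nxt_def)
  have "{l, nxt l} = {l', nxt l'}" using levels[OF l(1), of e b] levels[OF l(2), of e' b'] eq lb lb' by simp
  \<comment> \<open>The levels form a cycle of odd length at least 3, so an edge determines its
    lower level from its unordered end points.\<close>
  then have ll: "l' = l" using l t by (auto simp: doubleton_eq_iff nxt_def split: if_splits)
  have "fst (vertex t l i c) \<noteq> fst (vertex t (Suc l) i' c')" for i i' c c'
    using l t by (auto simp: vertex_def)
  then have v: "vertex t l (\<sigma> (l div 2) e) b = vertex t l (\<sigma> (l div 2) e') b'"
    "vertex t (Suc l) (\<sigma> (Suc l div 2) e) (b \<noteq> turn \<sigma> X W e l) =
     vertex t (Suc l) (\<sigma> (Suc l div 2) e') (b' \<noteq> turn \<sigma> X W e' l)"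
    using eq unfolding lb lb' ll step_def prod.case doubleton_eq_iff by metis+
  have "e = e' \<and> b = b'"
  \<comment> \<open>A hub forgets the position, so on level 0 the hyperedge is read off the upper
    end point.\<close>
  proof (cases "l = 0")
    case True
    have "vertex t 1 i c = (1, i, c)" for i c using t by (auto simp: vertex_def)
    then have "\<sigma> 0 e = \<sigma> 0 e'" and b: "(b \<noteq> turn \<sigma> X W e 0) = (b' \<noteq> turn \<sigma> X W e' 0)"
      using v(2) True by simp_all
    then have "e = e'" using sigma_inj[of 0] t by simp
    then show ?thesis using b by auto
  next
    case False
    then have "vertex t l i c = (l, i, c)" for i c using l by (simp add: vertex_def)
    then have "\<sigma> (l div 2) e = \<sigma> (l div 2) e'" "b = b'" using v(1) by simp_all
    then show ?thesis using sigma_inj[of "l div 2"] l by auto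
  qed
  then show "x = x'" using lb lb' ll by simp
qed

lemma set_streams: "set (alice_stream t m X @ bob_stream t N \<sigma> W) = step t \<sigma> X W ` steps t m N"
proof (intro equalityI subsetI)
  fix E assume "E \<in> set (alice_stream t m X @ bob_stream t N \<sigma> W)"
  then consider
      (alice) j i b where "j < t" "i < m" "E = alice_edge t X (j, i, b)"
    | (bob) j e b where "j < t - 1" "e < N" "E = bob_edge t \<sigma> W (j, e, b)"
    by (fastforce simp: alice_stream_def bob_stream_def)
  then show "E \<in> step t \<sigma> X W ` steps t m N"
  proof cases
    case alice
    define e where "e = inv (\<sigma> j) i"
    have p: "\<sigma> j permutes {..<m}" using matchings_permutes[OF \<sigma>] alice by simp
    have "e < m" using permutes_in_image[OF permutes_inv[OF p], of i] alice by (simp add: e_def)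
    moreover have "\<sigma> j e = i" using p by (simp add: e_def permutes_inverses)
    ultimately have "E = step t \<sigma> X W (2 * j, e, b)" "(2 * j, e, b) \<in> steps t m N"
      using alice by (auto simp: alice_edge_def step_def turn_def steps_def)
    then show ?thesis by blast
  next
    case bob
    then have "E = step t \<sigma> X W (2 * j + 1, e, b)" "(2 * j + 1, e, b) \<in> steps t m N"
      by (auto simp: bob_edge_def step_def turn_def steps_def)
    then show ?thesis by blast
  qed
next
  fix E assume "E \<in> step t \<sigma> X W ` steps t m N"
  then obtain l e b where l: "(l, e, b) \<in> steps t m N" and E: "E = step t \<sigma> X W (l, e, b)" by auto
  show "E \<in> set (alice_stream t m X @ bob_stream t N \<sigma> W)"
  proof (cases "even l")
    case True
    then obtain j where j: "l = 2 * j" by (elim evenE)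
    then have "j < t" "e < m" using l by (auto simp: steps_def)
    then have "E = alice_edge t X (j, \<sigma> j e, b)" "\<sigma> j e < m"
      using E j sigma_lt by (auto simp: alice_edge_def step_def turn_def)
    then show ?thesis using \<open>j < t\<close> by (auto simp: alice_stream_def)
  next
    case False
    then obtain j where j: "l = 2 * j + 1" by (elim oddE)
    then have "j < t - 1" "e < N" using l by (auto simp: steps_def)
    moreover have "E = bob_edge t \<sigma> W (j, e, b)"
      using E j by (auto simp: bob_edge_def step_def turn_def)
    ultimately show ?thesis by (auto simp: bob_stream_def)
  qed
qed

text \<open>The stream is as long as there are steps, and distinct steps are distinct edges.\<close>

lemma distinct_streams: "distinct (alice_stream t m X @ bob_stream t N \<sigma> W)"
proof (rule card_distinct)
  show "card (set (alice_stream t m X @ bob_stream t N \<sigma> W)) =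
      length (alice_stream t m X @ bob_stream t N \<sigma> W)"
    unfolding set_streams card_image[OF inj_on_step] using t
    by (simp add: card_steps alice_stream_def bob_stream_def mult_2_right)
qed

text \<open>
  If every hyperedge has total turn \<open>0\<close>, then the \<open>2 * N\<close> walks of length \<open>2 * t - 1\<close>
  starting at the hubs are closed and edge-disjoint, so each contains an uncut edge of its own.
\<close>

lemma card_monochromatic_steps_ge:
  fixes col :: "nat \<times> nat \<times> bool \<Rightarrow> bool"
  shows "2 * N \<le> card {x \<in> steps t m N.
    \<forall>u\<in>step t \<sigma> X (odd_hyperedges t N \<sigma> X) x. \<forall>v\<in>step t \<sigma> X (odd_hyperedges t N \<sigma> X) x. col u = col v}"
proof -
  let ?W = "odd_hyperedges t N \<sigma> X"
  let ?M = "{x \<in> steps t m N. \<forall>u\<in>step t \<sigma> X ?W x. \<forall>v\<in>step t \<sigma> X ?W x. col u = col v}"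
  define v where "v e b l = vertex t l (\<sigma> (l div 2) e) (b \<noteq> total_turn \<sigma> X ?W e l)" for e b l
  have st: "step t \<sigma> X ?W (l, e, b \<noteq> total_turn \<sigma> X ?W e l) = {v e b l, v e b (Suc l)}" for e b l
  proof -
    have "(b \<noteq> total_turn \<sigma> X ?W e (Suc l)) = ((b \<noteq> total_turn \<sigma> X ?W e l) \<noteq> turn \<sigma> X ?W e l)"
      by auto
    then show ?thesis by (simp only: step_def v_def prod.case)
  qed
  have "\<exists>l<2 * t - 1. col (v e b l) = col (v e b (Suc l))" if e: "e < N" for e b
  \<comment> \<open>Alternating colours along a closed walk of odd length is impossible.\<close>
  proof (rule ccontr)
    assume "\<not> ?thesis"
    then have *: "col (v e b (Suc l)) = (\<not> col (v e b l))" if "l < 2 * t - 1" for l using that by auto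
    have "col (v e b l) = (col (v e b 0) \<noteq> odd l)" if "l \<le> 2 * t - 1" for l
      using that by (induction l) (auto simp: *)
    from this[of "2 * t - 1"] have "col (v e b (2 * t - 1)) \<noteq> col (v e b 0)" using t by auto
    moreover have "\<not> total_turn \<sigma> X ?W e (2 * t - 1)"
      unfolding total_turn_hub[OF t] using e by (simp add: odd_hyperedges_def)
    then have "v e b (2 * t - 1) = v e b 0" by (simp add: v_def vertex_def)
    ultimately show False by simp
  qed
  then obtain l where l: "\<And>e b. e < N \<Longrightarrow> l e b < 2 * t - 1"
    "\<And>e b. e < N \<Longrightarrow> col (v e b (l e b)) = col (v e b (Suc (l e b)))"
    by metis
  \<comment> \<open>One uncut step is chosen per walk. Hyperedge, level and side together recover
    the starting hub \<open>b\<close>, so different walks give different steps.\<close>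
  define f where "f = (\<lambda>(e, b). (l e b, e, b \<noteq> total_turn \<sigma> X ?W e (l e b)))"
  have "card (f ` ({..<N} \<times> UNIV)) = card ({..<N} \<times> (UNIV :: bool set))"
    by (intro card_image inj_onI) (auto simp: f_def)
  also have "\<dots> = 2 * N" by (simp add: card_cartesian_product)
  finally have "2 * N = card (f ` ({..<N} \<times> UNIV))" by simp
  also have "\<dots> \<le> card ?M"
  proof (rule card_mono)
    show "finite ?M" using finite_steps by simp
    show "f ` ({..<N} \<times> UNIV) \<subseteq> ?M"
    proof (rule image_subsetI)
      fix x :: "nat \<times> bool" assume "x \<in> {..<N} \<times> UNIV"
      then obtain e b where x: "x = (e, b)" "e < N" by auto
      then show "f x \<in> ?M"
        using l[of e b] Nm unfolding f_def x prod.case mem_Collect_eq st by (auto simp: steps_def)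
    qed
  qed
  finally show ?thesis .
qed

text \<open>The colour is the parity of the level, corrected by the side traced back to the hub. To
  colour positions off Bob's hyperedges too, the labels are extended to all \<open>m\<close>
  hyperedges as \<open>W'\<close>; the two label sets agree wherever Bob has an edge.\<close>

lemma proper_coloring_exists:
  "\<exists>col :: nat \<times> nat \<times> bool \<Rightarrow> bool. \<forall>l e b. (l, e, b) \<in> steps t m N \<longrightarrow> col (vertex t l (\<sigma> (l div 2) e) b) \<noteq>
    col (vertex t (Suc l) (\<sigma> (Suc l div 2) e) (b \<noteq> turn \<sigma> X ({..<N} - odd_hyperedges t N \<sigma> X) e l))"
proof -
  let ?W = "{..<N} - odd_hyperedges t N \<sigma> X"
  define W' where "W' = {..<m} - odd_hyperedges t m \<sigma> X"
  define col where "col = (\<lambda>(p, i, b).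
      (b \<noteq> total_turn \<sigma> X W' (inv (\<sigma> (p div 2)) i) p) \<noteq> odd p)"
  have col: "col (vertex t p (\<sigma> (p div 2) e) b) = ((b \<noteq> total_turn \<sigma> X W' e p) \<noteq> odd p)"
    if "p \<le> 2 * t - 1" "e < m" for p e b
  proof (cases "p = 2 * t - 1")
    case True
    \<comment> \<open>The odd total turn compensates for the odd length, making the colour at level
      \<open>2 * t - 1\<close> agree with that of the hub.\<close>
    have "total_turn \<sigma> X W' e (2 * t - 1)"
      unfolding total_turn_hub[OF t] using that by (auto simp: W'_def odd_hyperedges_def)
    then show ?thesis using t by (auto simp: True col_def vertex_def)
  next
    case False
    have "\<sigma> (p div 2) permutes {..<m}" using that t by (intro matchings_permutes[OF \<sigma>]) auto
    then have "inv (\<sigma> (p div 2)) (\<sigma> (p div 2) e) = e" by (simp add: permutes_inverses)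
    then show ?thesis using False by (auto simp: col_def vertex_def)
  qed
  have "col (vertex t l (\<sigma> (l div 2) e) b) \<noteq>
      col (vertex t (Suc l) (\<sigma> (Suc l div 2) e) (b \<noteq> turn \<sigma> X ?W e l))"
    if "(l, e, b) \<in> steps t m N" for l e b
  proof -
    have "l < 2 * t - 1" "e < m" "odd l \<longrightarrow> e < N" using that Nm by (auto simp: steps_def split: if_splits)
    moreover from this have "turn \<sigma> X ?W e l = turn \<sigma> X W' e l"
      by (auto simp: turn_def W'_def odd_hyperedges_def)
    ultimately show ?thesis by (simp add: col) blast
  qed
  then show ?thesis by (intro exI[of _ col] allI impI)
qed

end

section \<open>The streaming lower bound\<close>

lemma finite_cut_values:
  assumes "finite V"
  shows "finite {card (cut_edges E P Q) | P Q. P \<union> Q = V \<and> P \<inter> Q = {}}"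
  by (rule finite_subset[of _ "(\<lambda>(P, Q). card (cut_edges E P Q)) ` (Pow V \<times> Pow V)"])
    (use assms in auto)

lemma max_cut_leI:
  assumes "finite V" "\<And>P Q. P \<union> Q = V \<Longrightarrow> P \<inter> Q = {} \<Longrightarrow> card (cut_edges E P Q) \<le> k"
  shows "max_cut V E \<le> k"
proof -
  have "V \<union> {} = V \<and> V \<inter> {} = {}" by simp
  then have "{card (cut_edges E P Q) | P Q. P \<union> Q = V \<and> P \<inter> Q = {}} \<noteq> {}" by blast
  then show ?thesis
    unfolding max_cut_def using finite_cut_values[OF assms(1), of E] assms(2) by (subst Max_le_iff) auto
qed

lemma card_cut_edges_le_max_cut:
  assumes "finite V" "P \<union> Q = V" "P \<inter> Q = {}"
  shows "card (cut_edges E P Q) \<le> max_cut V E"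
  unfolding max_cut_def using assms by (intro Max_ge finite_cut_values) auto

context hidden_matching_graph
begin

text \<open>The map \<open>\<phi>\<close> places the gadget among the \<open>n\<close> vertices of
  the stream; the remaining vertices stay isolated.\<close>

context
  fixes \<phi> :: "nat \<times> nat \<times> bool \<Rightarrow> nat" and n :: nat
  assumes inj: "inj_on \<phi> (vertices t m)" and \<phi>: "\<phi> ` vertices t m \<subseteq> {..<n}"
begin

lemma inj_on_image_step: "inj_on (\<lambda>x. \<phi> ` step t \<sigma> X W x) (steps t m N)"
proof (rule inj_onI)
  fix x y assume *: "x \<in> steps t m N" "y \<in> steps t m N" "\<phi> ` step t \<sigma> X W x = \<phi> ` step t \<sigma> X W y"
  then have "step t \<sigma> X W x = step t \<sigma> X W y"
    using inj_on_image_eq_iff[OF inj, of "step t \<sigma> X W x" "step t \<sigma> X W y"] step_edge by simp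
  then show "x = y" using inj_on_step * by (auto dest: inj_onD)
qed

lemma edge_order_streams:
  "edge_order n ((\<lambda>x. \<phi> ` step t \<sigma> X W x) ` steps t m N)
    (map ((`) \<phi>) (alice_stream t m X @ bob_stream t N \<sigma> W))"
  unfolding edge_order_def simple_graph_def
proof (intro conjI ballI)
  fix e assume "e \<in> (\<lambda>x. \<phi> ` step t \<sigma> X W x) ` steps t m N"
  then obtain x where x: "x \<in> steps t m N" "e = \<phi> ` step t \<sigma> X W x" by auto
  then have sub: "step t \<sigma> X W x \<subseteq> vertices t m" and c: "card (step t \<sigma> X W x) = 2"
    using step_edge by auto
  show "e \<subseteq> {..<n}" using sub x \<phi> by auto
  show "card e = 2" using c x inj_on_subset[OF inj sub] by (simp add: card_image)
next
  have "inj_on ((`) \<phi>) (step t \<sigma> X W ` steps t m N)"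
    by (rule inj_on_subset[OF inj_on_image_Pow[OF inj]]) (use step_edge in blast)
  then show "distinct (map ((`) \<phi>) (alice_stream t m X @ bob_stream t N \<sigma> W))"
    unfolding distinct_map set_streams using distinct_streams by simp
  show "set (map ((`) \<phi>) (alice_stream t m X @ bob_stream t N \<sigma> W)) =
      (\<lambda>x. \<phi> ` step t \<sigma> X W x) ` steps t m N"
    unfolding set_map set_streams image_image ..
qed simp

lemma max_cut_consistent_ge:
  assumes "W = {..<N} - odd_hyperedges t N \<sigma> X"
  shows "card (steps t m N) \<le> max_cut {..<n} ((\<lambda>x. \<phi> ` step t \<sigma> X W x) ` steps t m N)"
proof -
  let ?E = "(\<lambda>x. \<phi> ` step t \<sigma> X W x) ` steps t m N"
  obtain col :: "nat \<times> nat \<times> bool \<Rightarrow> bool" where col: "\<And>l e b. (l, e, b) \<in> steps t m N \<Longrightarrow> col (vertex t l (\<sigma> (l div 2) e) b) \<noteq>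
      col (vertex t (Suc l) (\<sigma> (Suc l div 2) e) (b \<noteq> turn \<sigma> X W e l))"
    using proper_coloring_exists[of X] unfolding assms by blast
  define P where "P = \<phi> ` {u \<in> vertices t m. col u}"
  have P: "\<phi> u \<in> P \<longleftrightarrow> col u" if "u \<in> vertices t m" for u
    using that inj by (auto simp: P_def dest: inj_onD)
  have "?E \<subseteq> cut_edges ?E P ({..<n} - P)"
  proof
    fix E assume E: "E \<in> ?E"
    then obtain l e b where l: "(l, e, b) \<in> steps t m N" and E': "E = \<phi> ` step t \<sigma> X W (l, e, b)" by auto
    define u where "u = vertex t l (\<sigma> (l div 2) e) b"
    define v where "v = vertex t (Suc l) (\<sigma> (Suc l div 2) e) (b \<noteq> turn \<sigma> X W e l)"
    have uv: "E = {\<phi> u, \<phi> v}" "u \<in> vertices t m" "v \<in> vertices t m" "col u \<noteq> col v"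
      using E' step_vertices[OF l] col[OF l] by (simp_all add: step_def u_def v_def)
    then have "\<phi> u \<in> {..<n}" "\<phi> v \<in> {..<n}" using \<phi> by auto
    then have "\<phi> u \<in> P \<and> \<phi> v \<in> {..<n} - P \<or> \<phi> v \<in> P \<and> \<phi> u \<in> {..<n} - P"
      using uv(4) P[OF uv(2)] P[OF uv(3)] by auto
    then have "\<exists>p\<in>P. \<exists>q\<in>{..<n} - P. E = {p, q}" unfolding uv(1) by blast
    then show "E \<in> cut_edges ?E P ({..<n} - P)" using E by (simp add: cut_edges_def)
  qed
  then have "card ?E \<le> card (cut_edges ?E P ({..<n} - P))"
    using finite_steps by (intro card_mono) (auto simp: cut_edges_def)
  also have "\<dots> \<le> max_cut {..<n} ?E"
    using \<phi> by (intro card_cut_edges_le_max_cut) (auto simp: P_def)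
  finally show ?thesis by (simp add: card_image inj_on_image_step)
qed

lemma max_cut_inconsistent_le:
  assumes W: "W = odd_hyperedges t N \<sigma> X"
  shows "max_cut {..<n} ((\<lambda>x. \<phi> ` step t \<sigma> X W x) ` steps t m N) \<le> card (steps t m N) - 2 * N"
proof (rule max_cut_leI)
  fix P Q assume PQ: "P \<union> Q = {..<n}" "P \<inter> Q = {}"
  let ?E = "(\<lambda>x. \<phi> ` step t \<sigma> X W x) ` steps t m N"
  define M where "M = {x \<in> steps t m N. \<forall>u\<in>step t \<sigma> X W x. \<forall>v\<in>step t \<sigma> X W x. (\<phi> u \<in> P) = (\<phi> v \<in> P)}"
  have "cut_edges ?E P Q \<subseteq> (\<lambda>x. \<phi> ` step t \<sigma> X W x) ` (steps t m N - M)"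
  proof
    fix E assume "E \<in> cut_edges ?E P Q"
    then obtain x p q where x: "x \<in> steps t m N" "E = \<phi> ` step t \<sigma> X W x" "E = {p, q}" "p \<in> P" "q \<in> Q"
      by (auto simp: cut_edges_def)
    have "p \<in> \<phi> ` step t \<sigma> X W x" "q \<in> \<phi> ` step t \<sigma> X W x"
      unfolding x(2)[symmetric] x(3) by simp_all
    then obtain u v where uv: "u \<in> step t \<sigma> X W x" "v \<in> step t \<sigma> X W x" "p = \<phi> u" "q = \<phi> v"
      by (elim imageE)
    have "\<phi> u \<in> P" "\<phi> v \<notin> P" using x(4,5) uv(3,4) PQ(2) by auto
    then have "x \<notin> M" using uv(1,2) unfolding M_def by blast
    then show "E \<in> (\<lambda>x. \<phi> ` step t \<sigma> X W x) ` (steps t m N - M)" using x by blast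
  qed
  then have "card (cut_edges ?E P Q) \<le> card (steps t m N - M)"
    using finite_steps by (intro surj_card_le) auto
  also have "\<dots> = card (steps t m N) - card M"
    using finite_steps by (intro card_Diff_subset) (auto simp: M_def intro: finite_subset)
  also have "\<dots> \<le> card (steps t m N) - 2 * N"
    using card_monochromatic_steps_ge[of X "\<lambda>u. \<phi> u \<in> P"] unfolding M_def W by (intro diff_le_mono2)
  finally show "card (cut_edges ?E P Q) \<le> card (steps t m N) - 2 * N" .
qed simp

end

end

section \<open>From a streaming algorithm to a one-way protocol\<close>

text \<open>Updates see the position of an edge, so the second half is numbered from
  \<open>length xs\<close> on.\<close>

lemma final_mem_append:
  "final_mem A \<omega> (xs @ ys) =
    foldl (\<lambda>m (i, e). update_mem A \<omega> i m e) (final_mem A \<omega> xs) (List.enumerate (length xs) ys)"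
  by (simp add: final_mem_def enumerate_append_eq)

lemma edge_order_prefix: "edge_order n E (xs @ ys) \<Longrightarrow> edge_order n (set xs) xs"
  by (auto simp: edge_order_def simple_graph_def)

lemma card_bool_lists_le: "card {xs :: bool list. length xs \<le> s} \<le> 2 ^ (s + 1)"
proof -
  have "card {xs :: bool list. set xs \<subseteq> UNIV \<and> length xs \<le> s} = (\<Sum>i\<le>s. 2 ^ i)"
    by (subst card_lists_length_le) auto
  also have "\<dots> \<le> 2 ^ (s + 1)" by (induction s) auto
  finally show ?thesis by simp
qed

lemma finite_bool_lists_le: "finite {xs :: bool list. length xs \<le> s}"
  using finite_lists_length_le[of "UNIV :: bool set" s] by simp

text \<open>Each coin outcome gives a deterministic protocol, whose message is the memory after
  Alice's edges. There are at most \<open>2 ^ (s + 1)\<close> messages, and the factor 8 of the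
  protocol bound leads to \<open>s + 4\<close>. Averaged over the coins, the two success rates sum
  to at least 3/2, against at most 11/8 for each outcome.\<close>

lemma max_cut_space_gt:
  fixes A :: "'r stream_alg"
  assumes apx: "approximates_max_cut n (1 + 1 / (2 * real t)) A" and sp: "uses_space n A s"
    and t: "t \<ge> 2" and NK: "N + K \<le> m"
    and Km: "1024 * K ^ t \<le> m ^ (t - 1)" "real m * (2 * real K / real m) ^ K \<le> 1 / 256"
    and N: "t * m < (t + 2) * N" and n: "2 + (2 * t - 2) * m * 2 \<le> n"
  shows "K < s + 4"
proof (rule ccontr)
  assume "\<not> K < s + 4"
  then have sK: "s + 4 \<le> K" by simp
  interpret prob_space "coins A" using apx by (simp add: approximates_max_cut_def)
  obtain \<phi> :: "nat \<times> nat \<times> bool \<Rightarrow> nat" where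
    \<phi>: "inj_on \<phi> (vertices t m)" "\<phi> ` vertices t m \<subseteq> {..<n}"
    using inj_on_iff_card_le[of "vertices t m" "{..<n}"] n by (auto simp: finite_vertices card_vertices)
  have graph: "hidden_matching_graph t m N \<sigma>" if "\<sigma> \<in> matchings t m" for \<sigma>
    using that t NK by unfold_locales auto
  let ?U = "Pow ({..<t} \<times> {..<m})" and ?P = "matchings t m"
  define C where "C = card (steps t m N)"
  \<comment> \<open>Bob's threshold is the upper bound on the maximum cut when labels and parities
    agree.\<close>
  define \<tau> where "\<tau> = real C - 2 * real N"
  define E where "E X \<sigma> W = (\<lambda>x. \<phi> ` step t \<sigma> X W x) ` steps t m N" for X \<sigma> W
  define es where "es X \<sigma> W = map ((`) \<phi>) (alice_stream t m X @ bob_stream t N \<sigma> W)" for X \<sigma> W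
  define ok where "ok X \<sigma> W = {\<omega> \<in> space (coins A). result A \<omega> (final_mem A \<omega> (es X \<sigma> W))
      \<in> {real (max_cut {..<n} (E X \<sigma> W)) / (1 + 1 / (2 * real t)) .. real (max_cut {..<n} (E X \<sigma> W))}}"
    for X \<sigma> W
  define Y where "Y X \<sigma> = ok X \<sigma> ({..<N} - odd_hyperedges t N \<sigma> X)" for X \<sigma>
  define Z where "Z X \<sigma> = ok X \<sigma> (odd_hyperedges t N \<sigma> X)" for X \<sigma>
  define msg where "msg \<omega> X = final_mem A \<omega> (map ((`) \<phi>) (alice_stream t m X))" for \<omega> X
  \<comment> \<open>The numbering starts at the number of Alice's edges, so Bob needs nothing of
    \<open>X\<close> but the message.\<close>
  define g where "g \<omega> \<mu> \<sigma> W \<longleftrightarrow> result A \<omega> (foldl (\<lambda>m (i, e). update_mem A \<omega> i m e) \<mu>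
      (List.enumerate (t * (m * 2)) (map ((`) \<phi>) (bob_stream t N \<sigma> W)))) > \<tau>" for \<omega> \<mu> \<sigma> W
  have g: "g \<omega> (msg \<omega> X) \<sigma> W \<longleftrightarrow> result A \<omega> (final_mem A \<omega> (es X \<sigma> W)) > \<tau>" for \<omega> X \<sigma> W
    unfolding g_def msg_def es_def map_append final_mem_append
    by (simp add: alice_stream_def mult_2_right)
  have order: "edge_order n (E X \<sigma> W) (es X \<sigma> W)" if "\<sigma> \<in> ?P" for X \<sigma> W
    unfolding E_def es_def using hidden_matching_graph.edge_order_streams[OF graph[OF that] \<phi>] .
  have ok: "measure (coins A) (ok X \<sigma> W) \<ge> 3 / 4" if "\<sigma> \<in> ?P" for X \<sigma> W
    using apx order[OF that] unfolding approximates_max_cut_def ok_def by blast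
  \<comment> \<open>A non-measurable event has measure 0, so success with probability 3/4 forces
    measurability.\<close>
  have ok_sets: "ok X \<sigma> W \<in> sets (coins A)" if "\<sigma> \<in> ?P" for X \<sigma> W
  proof (rule ccontr)
    assume "ok X \<sigma> W \<notin> sets (coins A)"
    then show False using ok[OF that, of X W] by (simp add: measure_notin_sets)
  qed
  have C: "C = t * (m * 2) + (t - 1) * (N * 2)" using t by (simp add: C_def card_steps)
  have C2: "2 * N \<le> C"
  proof -
    have "N * 2 \<le> (t - 1) * (N * 2)" using t by (cases "t - 1") auto
    then show ?thesis unfolding C by linarith
  qed
  \<comment> \<open>Clearing denominators, this is \<open>C < 2 * N * (2 * t + 1)\<close>, which is
    the assumption \<open>t * m < (t + 2) * N\<close>. Strictness separates the least admissible
    output in the bipartite case from the threshold.\<close>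
  have gap: "\<tau> < real C / (1 + 1 / (2 * real t))"
  proof -
    have "t * (m * 2) + (t - 1) * (N * 2) + 2 * N = 2 * (t * m) + 2 * (t * N)"
      using t by (cases t) (auto simp: algebra_simps)
    then have "C < 2 * N * (2 * t + 1)" using N unfolding C by (simp add: algebra_simps)
    then have "real C < real (2 * N * (2 * t + 1))" by (rule of_nat_less_iff[THEN iffD2])
    then have "\<tau> * (1 + 2 * real t) < real C * (2 * real t)"
      by (simp add: \<tau>_def algebra_simps)
    moreover have "1 + 1 / (2 * real t) = (1 + 2 * real t) / (2 * real t)"
      using t by (simp add: field_simps)
    ultimately show ?thesis using t by (simp add: pos_less_divide_eq)
  qed
  have Yg: "g \<omega> (msg \<omega> X) \<sigma> ({..<N} - odd_hyperedges t N \<sigma> X)" if "\<omega> \<in> Y X \<sigma>" "\<sigma> \<in> ?P" for \<omega> X \<sigma>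
  proof -
    have "real C \<le> real (max_cut {..<n} (E X \<sigma> ({..<N} - odd_hyperedges t N \<sigma> X)))"
      unfolding E_def C_def
      using hidden_matching_graph.max_cut_consistent_ge[OF graph[OF that(2)] \<phi> refl] by simp
    then have "real C / (1 + 1 / (2 * real t)) \<le>
        real (max_cut {..<n} (E X \<sigma> ({..<N} - odd_hyperedges t N \<sigma> X))) / (1 + 1 / (2 * real t))"
      by (intro divide_right_mono) auto
    then show ?thesis unfolding g using that(1) gap by (auto simp: Y_def ok_def)
  qed
  have Zg: "\<not> g \<omega> (msg \<omega> X) \<sigma> (odd_hyperedges t N \<sigma> X)" if "\<omega> \<in> Z X \<sigma>" "\<sigma> \<in> ?P" for \<omega> X \<sigma>
  proof -
    have "max_cut {..<n} (E X \<sigma> (odd_hyperedges t N \<sigma> X)) \<le> C - 2 * N"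
      unfolding E_def C_def
      using hidden_matching_graph.max_cut_inconsistent_le[OF graph[OF that(2)] \<phi> refl] by simp
    then have "real (max_cut {..<n} (E X \<sigma> (odd_hyperedges t N \<sigma> X))) \<le> \<tau>"
      using C2 by (simp add: \<tau>_def of_nat_diff)
    then show ?thesis unfolding g using that(1) by (auto simp: Z_def ok_def)
  qed
  have YZ: "Y X \<sigma> \<in> sets (coins A)" "Z X \<sigma> \<in> sets (coins A)"
    "measure (coins A) (Y X \<sigma>) \<ge> 3 / 4" "measure (coins A) (Z X \<sigma>) \<ge> 3 / 4" if "\<sigma> \<in> ?P" for X \<sigma>
    using ok ok_sets that by (auto simp: Y_def Z_def)
  let ?f = "\<lambda>\<omega>. \<Sum>X\<in>?U. \<Sum>\<sigma>\<in>?P. indicator (Y X \<sigma>) \<omega> + indicator (Z X \<sigma>) \<omega> :: real"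
  have bound: "?f \<omega> \<le> 11 / 8 * card (?U \<times> ?P)" if \<omega>: "\<omega> \<in> space (coins A)" for \<omega>
  proof -
    have "?f \<omega> \<le> (\<Sum>X\<in>?U. \<Sum>\<sigma>\<in>?P.
        of_bool (g \<omega> (msg \<omega> X) \<sigma> ({..<N} - odd_hyperedges t N \<sigma> X)) +
        of_bool (\<not> g \<omega> (msg \<omega> X) \<sigma> (odd_hyperedges t N \<sigma> X)))"
      using Yg Zg by (intro sum_mono add_mono) (auto simp: indicator_def)
    also have "\<dots> \<le> 11 / 8 * card (?U \<times> ?P)"
    proof (rule hidden_matching_protocol_success_le[OF t NK Km])
      \<comment> \<open>Space is bounded on edge orders only; any matching completes Alice's edges
        to one, and prefixes inherit the property.\<close>
      have "?P \<noteq> {}"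
        using card_matchings[of t m] by (metis card.empty fact_nonzero power_not_zero)
      then obtain \<sigma> where \<sigma>: "\<sigma> \<in> ?P" by blast
      have "msg \<omega> ` ?U \<subseteq> {xs. length xs \<le> s}"
      proof (rule image_subsetI)
        fix X
        have "edge_order n (set (map ((`) \<phi>) (alice_stream t m X))) (map ((`) \<phi>) (alice_stream t m X))"
          using order[OF \<sigma>, of X "{}"] unfolding es_def map_append by (rule edge_order_prefix)
        then show "msg \<omega> X \<in> {xs. length xs \<le> s}"
          using sp \<omega> unfolding uses_space_def msg_def by blast
      qed
      then have "card (msg \<omega> ` ?U) \<le> 2 ^ (s + 1)"
        using card_mono[OF finite_bool_lists_le] card_bool_lists_le order_trans by blast
      then have "8 * card (msg \<omega> ` ?U) \<le> 2 ^ (s + 4)" by (simp add: power_add)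
      also have "\<dots> \<le> 2 ^ K" using sK by (intro power_increasing) auto
      finally show "8 * card (msg \<omega> ` ?U) \<le> 2 ^ K" .
    qed
    finally show ?thesis .
  qed
  have int: "integrable (coins A) (\<lambda>\<omega>. indicator (Y X \<sigma>) \<omega> + indicator (Z X \<sigma>) \<omega> :: real)"
    if "\<sigma> \<in> ?P" for X \<sigma>
    using YZ[OF that] by (intro Bochner_Integration.integrable_add integrable_real_indicator)
      (auto simp: emeasure_eq_measure)
  have "3 / 2 * card (?U \<times> ?P) = (\<Sum>X\<in>?U. \<Sum>\<sigma>\<in>?P. 3 / 4 + 3 / 4 :: real)"
    by (simp add: card_cartesian_product)
  also have "\<dots> \<le> (\<Sum>X\<in>?U. \<Sum>\<sigma>\<in>?P. measure (coins A) (Y X \<sigma>) + measure (coins A) (Z X \<sigma>))"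
    using YZ by (intro sum_mono add_mono)
  also have "\<dots> = (\<Sum>X\<in>?U. \<Sum>\<sigma>\<in>?P. expectation (\<lambda>\<omega>. indicator (Y X \<sigma>) \<omega> + indicator (Z X \<sigma>) \<omega>))"
  proof (intro sum.cong refl)
    fix X \<sigma> assume "\<sigma> \<in> ?P"
    then show "measure (coins A) (Y X \<sigma>) + measure (coins A) (Z X \<sigma>) =
        expectation (\<lambda>\<omega>. indicator (Y X \<sigma>) \<omega> + indicator (Z X \<sigma>) \<omega>)"
      using YZ[of \<sigma> X] by (subst Bochner_Integration.integral_add)
        (auto simp: emeasure_eq_measure intro!: integrable_real_indicator)
  qed
  also have "\<dots> = expectation ?f"
    using int by (subst Bochner_Integration.integral_sum; (intro Bochner_Integration.integrable_sum)?)
      (auto intro!: sum.cong simp: Bochner_Integration.integral_sum)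
  also have "\<dots> \<le> 11 / 8 * card (?U \<times> ?P)"
    using int bound by (intro integral_le_const Bochner_Integration.integrable_sum AE_I2) auto
  finally have "card (?U \<times> ?P) = 0" by simp
  then show False by (simp add: card_cartesian_product card_matchings card_Pow)
qed

section \<open>Choice of the parameters\<close>

text \<open>With \<open>N = m - K\<close> the last bound amounts to
  \<open>(t + 2) * K < 2 * m\<close>, which follows from \<open>t + 2 \<le> m powr (1 / t)\<close>.
  For the bound before it, the base is at most 1/2, and \<open>t \<ge> 2\<close> makes
  \<open>K\<close> at least \<open>sqrt m / 1024 - 1\<close>.\<close>

lemma matching_size_bounds:
  fixes t m :: nat
  assumes t: "t \<ge> 2" and m: "m \<ge> (t + 2) ^ t"
    and m2: "real m * 2 powr (1 - sqrt (real m) / 1024) \<le> 1 / 256"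
  defines "K \<equiv> nat \<lfloor>real m powr (1 - 1 / real t) / 1024\<rfloor>"
  shows "real K \<ge> real m powr (1 - 1 / real t) / 1024 - 1" "K \<le> m"
    "1024 * K ^ t \<le> m ^ (t - 1)" "real m * (2 * real K / real m) ^ K \<le> 1 / 256"
    "t * m < (t + 2) * (m - K)"
proof -
  let ?x = "real m powr (1 - 1 / real t)"
  have "(t + 2) ^ t \<ge> 1" by simp
  then have m0: "m \<ge> 1" using m by linarith
  have x0: "?x \<ge> 0" by simp
  show K1: "real K \<ge> ?x / 1024 - 1" unfolding K_def by linarith
  have K2: "real K \<le> ?x / 1024" unfolding K_def using x0 by (intro of_nat_floor) simp
  have xt: "?x ^ t = real m ^ (t - 1)"
  proof -
    have "?x ^ t = real m powr ((1 - 1 / real t) * real t)"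
      using m0 by (subst powr_realpow[symmetric]) (simp_all add: powr_powr)
    also have "(1 - 1 / real t) * real t = real (t - 1)"
      using t by (simp add: field_simps of_nat_diff)
    finally show ?thesis using m0 by (simp add: powr_realpow)
  qed
  have "?x \<le> real m powr 1" using m0 t by (intro powr_mono) auto
  then have xm: "?x \<le> real m" by simp
  then have Km: "1024 * real K \<le> real m" using K2 by simp
  then show "K \<le> m" by linarith
  have "real (1024 * K ^ t) \<le> 1024 * (?x / 1024) ^ t"
    using K2 by (simp add: power_mono)
  also have "\<dots> = 1024 / 1024 ^ t * real m ^ (t - 1)" by (simp add: power_divide xt)
  also have "\<dots> \<le> 1 * real m ^ (t - 1)"
    using t self_le_power[of "1024::real" t] by (intro mult_right_mono) auto
  finally have "real (1024 * K ^ t) \<le> real (m ^ (t - 1))" by simp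
  then show "1024 * K ^ t \<le> m ^ (t - 1)" by (rule of_nat_le_iff[THEN iffD1])
  show "real m * (2 * real K / real m) ^ K \<le> 1 / 256"
  proof -
    have "2 * real K / real m \<le> 1 / 2" using Km m0 by (simp add: field_simps)
    then have "(2 * real K / real m) ^ K \<le> (1 / 2) ^ K" by (intro power_mono) auto
    also have "\<dots> = 2 powr (- real K)" by (simp add: powr_minus powr_realpow field_simps power_divide)
    also have "\<dots> \<le> 2 powr (1 - sqrt (real m) / 1024)"
    proof (rule powr_mono)
      have "real m powr (1 / 2) \<le> ?x" using m0 t by (intro powr_mono) (auto simp: field_simps)
      then have "sqrt (real m) \<le> ?x" by (simp add: powr_half_sqrt)
      then show "- real K \<le> 1 - sqrt (real m) / 1024" using K1 by linarith
    qed simp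
    finally have "real m * (2 * real K / real m) ^ K \<le> real m * 2 powr (1 - sqrt (real m) / 1024)"
      by (intro mult_left_mono) auto
    then show ?thesis using m2 by linarith
  qed
  have "real (t + 2) = (real (t + 2) ^ t) powr (1 / real t)"
    using t by (subst powr_realpow[symmetric]) (simp_all add: powr_powr)
  also have "\<dots> \<le> real m powr (1 / real t)"
  proof (rule powr_mono2)
    have "real ((t + 2) ^ t) \<le> real m" using m by (rule of_nat_mono)
    then show "real (t + 2) ^ t \<le> real m" by simp
  qed auto
  finally have "real (t + 2) * real K \<le> real m powr (1 / real t) * (?x / 1024)"
    using K2 by (intro mult_mono) auto
  also have "\<dots> = real m / 1024" using m0 by (simp flip: powr_add)
  also have "\<dots> < 2 * real m" using m0 by simp
  finally have "real ((t + 2) * K) < real (2 * m)" by (simp add: algebra_simps)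
  then have "(t + 2) * K < 2 * m" by (rule of_nat_less_iff[THEN iffD1])
  then show "t * m < (t + 2) * (m - K)"
    unfolding diff_mult_distrib2 add_mult_distrib by linarith
qed

theorem theorem3:
  fixes t :: nat
  assumes "t \<ge> 2"
  shows "\<exists>c::real. c > 0 \<and> (\<exists>n0. \<forall>n\<ge>n0. \<forall>(A :: 'r stream_alg) s.
           approximates_max_cut n (1 + 1 / (2 * real t)) A \<longrightarrow> uses_space n A s \<longrightarrow>
           real s \<ge> c * real n powr (1 - 1 / real t))"
proof -
  \<comment> \<open>The number 16384 is \<open>2 * 8 * 1024\<close>:
    \<open>n \<le> 8 * t * m\<close> costs at most \<open>8 * t\<close>, the definition of
    \<open>K\<close> costs 1024, and a factor 2 absorbs the additive loss of 5.\<close>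
  define c :: real where "c = 1 / (16384 * real t)"
  have c: "c > 0" using assms by (simp add: c_def)
  have "((\<lambda>m::nat. real m * 2 powr (1 - sqrt (real m) / 1024)) \<longlongrightarrow> 0) sequentially"
    by real_asymp
  then have "\<forall>\<^sub>F m in sequentially. real m * 2 powr (1 - sqrt (real m) / 1024) < 1 / 256"
    by (rule order_tendstoD) simp
  then obtain m0 where m0: "\<And>m. m \<ge> m0 \<Longrightarrow> real m * 2 powr (1 - sqrt (real m) / 1024) < 1 / 256"
    by (auto simp: eventually_sequentially)
  define m1 where "m1 = max m0 ((t + 2) ^ t)"
  \<comment> \<open>The last summand ensures \<open>c * sqrt n \<ge> 5\<close>, enough for the
    additive loss as \<open>1 - 1 / t \<ge> 1 / 2\<close>.\<close>
  define n0 where "n0 = 8 * t * m1 + 8 * t + nat \<lceil>(5 / c)\<^sup>2\<rceil>"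
  have "real s \<ge> c * real n powr (1 - 1 / real t)"
    if n: "n \<ge> n0" and apx: "approximates_max_cut n (1 + 1 / (2 * real t)) A"
      and sp: "uses_space n A s" for n s and A :: "'r stream_alg"
  proof -
    define X where "X = real n powr (1 - 1 / real t)"
    \<comment> \<open>The largest \<open>m\<close> whose gadget, with
      \<open>2 + 4 * (t - 1) * m\<close> vertices, fits into \<open>n\<close> vertices.\<close>
    define m where "m = (n - 2) div (4 * (t - 1))"
    define K where "K = nat \<lfloor>real m powr (1 - 1 / real t) / 1024\<rfloor>"
    have n8: "n \<ge> 8 * t * m1 + 8 * t" using n by (simp add: n0_def)
    have nm: "n \<le> 8 * t * m"
    proof -
      obtain u where u: "t = Suc u" using assms by (cases t) auto
      have "n - 2 < 4 * (t - 1) + m * (4 * (t - 1))"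
        unfolding m_def using assms by (intro dividend_less_div_times) auto
      then have "n - 2 < 4 * u + 4 * (u * m)" by (simp add: u algebra_simps)
      moreover have "n \<ge> 8 * u + 8" using n8 by (simp add: u)
      moreover have "8 * t * m = 8 * (u * m) + 8 * m" by (simp add: u algebra_simps)
      ultimately show ?thesis by linarith
    qed
    have "8 * t * m1 \<le> 8 * t * m" using n8 nm by linarith
    then have "m \<ge> m1" using assms by simp
    then have "m \<ge> (t + 2) ^ t" "m \<ge> m0" by (auto simp: m1_def)
    then have K: "real K \<ge> real m powr (1 - 1 / real t) / 1024 - 1" "K \<le> m"
      "1024 * K ^ t \<le> m ^ (t - 1)" "real m * (2 * real K / real m) ^ K \<le> 1 / 256"
      "t * m < (t + 2) * (m - K)"
      unfolding K_def using matching_size_bounds[OF assms, of m] m0[of m] by auto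
    have "4 * (t - 1) * m \<le> n - 2" unfolding m_def by simp
    moreover have "(2 * t - 2) * m * 2 = 4 * (t - 1) * m" by (cases t) auto
    ultimately have "2 + (2 * t - 2) * m * 2 \<le> n" using n8 assms by linarith
    then have "K < s + 4"
      using K apx sp assms by (intro max_cut_space_gt[where N = "m - K"]) auto
    then have sK: "real K < real s + 4" by simp
    have "X \<le> (8 * real t * real m) powr (1 - 1 / real t)"
    proof -
      have "real n \<le> real (8 * t * m)" using nm by (rule of_nat_mono)
      then show ?thesis unfolding X_def using assms by (intro powr_mono2) auto
    qed
    also have "\<dots> = (8 * real t) powr (1 - 1 / real t) * real m powr (1 - 1 / real t)"
      by (simp add: powr_mult)
    also have "\<dots> \<le> (8 * real t) powr 1 * real m powr (1 - 1 / real t)"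
      using assms by (intro mult_right_mono powr_mono) auto
    finally have "X / (8 * real t) \<le> real m powr (1 - 1 / real t)"
      using assms by (simp add: field_simps)
    then have "2 * (c * X) \<le> real m powr (1 - 1 / real t) / 1024" by (simp add: c_def)
    then have KX: "2 * (c * X) - 1 \<le> real K" using K(1) by linarith
    have "5 / c \<le> sqrt (real n)"
    proof (rule real_le_rsqrt)
      have "(5 / c)\<^sup>2 \<le> real (nat \<lceil>(5 / c)\<^sup>2\<rceil>)" by (rule real_nat_ceiling_ge)
      also have "\<dots> \<le> real n" using n by (simp add: n0_def)
      finally show "(5 / c)\<^sup>2 \<le> real n" .
    qed
    also have "sqrt (real n) = real n powr (1 / 2)" by (simp add: powr_half_sqrt)
    also have "\<dots> \<le> X"
      unfolding X_def using n8 assms by (intro powr_mono) (auto simp: field_simps)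
    finally have "5 \<le> c * X" using c by (simp add: field_simps)
    then show ?thesis using KX sK unfolding X_def by linarith
  qed
  then show ?thesis using c by blast
qed

end
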